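(* Let $(X_k)_{k\ge 1}$ be a sequence of independent real-valued random variables with $\mathbb{E}X_k=0$ and finite variances $\sigma_k^2=\mathbb{E}X_k^2\in(0,\infty)$. Assume that, for every $k\ge 1$, the law of $X_k$ has an absolutely continuous density $p_k$ satisfying $J(X_k)<\infty$. For $n\ge 2$ put $b_n=\sqrt{\sigma_1^2+\cdots+\sigma_n^2}$ and $S_n=\frac{X_1+\cdots+X_n}{b_n}$, and let $N$ be a standard normal random variable. Then $$d_{TV}(S_n,N)\le \left(\frac{8\pi\max_{1\le k\le n}J(X_k)}{1-\max_{1\le k\le n}(\sigma_k^2/b_n^2)}\right)^{1/2}\frac{\sum_{k=1}^n\mathbb{E}\big[|X_k|^2\,(b_n\wedge|X_k|)\big]}{b_n^3}.$$
   Context: Notation: $a\wedge b=\min(a,b)$. For real random variables $U,V$, the total variation distance between their laws is $d_{TV}(U,V)=\frac12\sup_{\|h\|_\infty\le 1}|\mathbb{E}h(U)-\mathbb{E}h(V)|$, where the supremum is over measurable $h:\mathbb{R}\to\mathbb{R}$ with $\|h\|_\infty:=\sup_{x\in\mathbb{R}}|h(x)|\le 1$. For a random variable $X$ with finite variance and an absolutely continuous density $p$ (with Radon-Nikodym derivative $p'$), the score function is $\rho=p'/p$ (on $\{p>0\}$), the standardised Fisher information is $$J_{st}(X)=\mathrm{Var}(X)\int_{-\infty}^{+\infty}\frac{p'(x)^2}{p(x)}\,dx-1=\mathrm{Var}(X)\,\mathbb{E}[\rho^2(X)]-1$$ (the integral being taken over $\{p>0\}$), and $J(X):=J_{st}(X)+1=\mathrm{Var}(X)\,\mathbb{E}[\rho^2(X)]$.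 *)

theory Defs
  imports "HOL-Probability.Probability"
begin

definition tv_dist :: "'a measure \<Rightarrow> ('a \<Rightarrow> real) \<Rightarrow> 'b measure \<Rightarrow> ('b \<Rightarrow> real) \<Rightarrow> real" where
  "tv_dist M U M' V =
     1 / 2 * (SUP h \<in> {h \<in> borel_measurable borel. \<forall>x. \<bar>h x\<bar> \<le> (1::real)}.
                \<bar>(\<integral>w. h (U w) \<partial>M) - (\<integral>w. h (V w) \<partial>M')\<bar>)"

(* Epsilon-delta absolute continuity on every compact interval.  If p is a density
   with finite Fisher information then p' is integrable on the whole line by
   Cauchy-Schwarz, so this is then the same as absolute continuity on the line. *)
definition abs_cont :: "(real \<Rightarrow> real) \<Rightarrow> bool" where
  "abs_cont f \<longleftrightarrow>
     (\<forall>a b. \<forall>\<epsilon>>0. \<exists>\<delta>>0. \<forall>(m::nat) u v.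
        (\<forall>i<m. a \<le> u i \<and> u i \<le> v i \<and> v i \<le> b) \<longrightarrow>
        disjoint_family_on (\<lambda>i. {u i<..<v i}) {..<m} \<longrightarrow>
        (\<Sum>i<m. v i - u i) < \<delta> \<longrightarrow>
        (\<Sum>i<m. \<bar>f (v i) - f (u i)\<bar>) < \<epsilon>)"

(* g is the density with respect to Lebesgue measure of the signed Stieltjes measure
   of f.  An absolutely continuous f has such a g, unique almost everywhere. *)
definition has_RN_derivative :: "(real \<Rightarrow> real) \<Rightarrow> (real \<Rightarrow> real) \<Rightarrow> bool" where
  "has_RN_derivative f g \<longleftrightarrow>
     (\<forall>a b. a \<le> b \<longrightarrow>
        set_integrable lborel {a..b} g \<and> f b - f a = (LINT x:{a..b}|lborel. g x))"

(* J(X) = J_st(X) + 1 for X with density p and Radon-Nikodym derivative p' of p;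
   extended-valued, so that J(X) < \<infinity> is a condition. *)
definition fisher_J ::
  "'a measure \<Rightarrow> ('a \<Rightarrow> real) \<Rightarrow> (real \<Rightarrow> real) \<Rightarrow> (real \<Rightarrow> real) \<Rightarrow> ennreal" where
  "fisher_J M X p p' =
     ennreal (prob_space.variance M X) *
     (\<integral>\<^sup>+x\<in>{x. 0 < p x}. ennreal ((p' x)\<^sup>2 / p x) \<partial>lborel)"

end

theory Submission
  imports Defs "HOL-Real_Asymp.Real_Asymp"
begin

text \<open>
  The proof combines Stein's equation with an integration by parts against the score functions.

  For \<open>h\<close> with values in \<open>[-1, 1]\<close>, Stein's equation \<open>f' x - x * f x = h x - E h(N)\<close> has a solution with
  \<open>\<bar>f\<bar> \<le> sqrt (2 * pi)\<close> and \<open>\<bar>f'\<bar> \<le> 4\<close> (\<open>stein_equation_solution\<close>), so it suffices to bound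
  \<open>E f'(S) - E (S * f S)\<close> for the normalised sum \<open>S\<close>.  Isolate one summand: \<open>S = Y + Z\<close> with \<open>Y\<close>, \<open>Z\<close>
  independent, and put \<open>F z = E f'(Y + z)\<close>.  If \<open>\<bar>F x - F t\<bar> \<le> C * min \<bar>x - t\<bar> 1\<close>, then a first order
  expansion around \<open>Z = 0\<close> shows that \<open>E Z\<^sup>2 * E f'(S)\<close> and \<open>E (Z * f S)\<close> differ by at most
  \<open>2 * C * E (Z\<^sup>2 * min \<bar>Z\<bar> 1)\<close> (\<open>stein_one_summand\<close>); adding these up over the summands
  (\<open>stein_sum\<close>) gives the sum in the theorem.

  The function \<open>f'\<close> is as rough as \<open>h\<close>, so the smoothness of \<open>F\<close> has to come from the law of \<open>Y\<close>.  The
  key estimate is \<open>\<bar>E g'(T)\<bar> \<le> sup \<bar>g\<bar> * sqrt (J / Var T)\<close> for a sum \<open>T\<close> of independent variables whose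
  quantities \<open>J(X\<^sub>i)\<close> are at most \<open>J\<close> (\<open>expectation_derivative_sum_le\<close>).  Integrating by parts in the
  \<open>i\<close>-th variable alone gives \<open>E g'(T) = - E (\<rho>\<^sub>i(X\<^sub>i) * g T)\<close> for the score \<open>\<rho>\<^sub>i = p\<^sub>i' / p\<^sub>i\<close>, for every
  \<open>i\<close>.  Averaging these identities with the weights \<open>\<sigma>\<^sub>i\<^sup>2 / Var T\<close> replaces the score by a weighted sum of
  independent centred scores, whose second moment is at most \<open>J / Var T\<close>.  This is the classical
  subadditivity of Fisher information, without densities of sums or conditional expectations.

  Apply the key estimate to \<open>g = f (\<cdot> + x) - f (\<cdot> + t)\<close>, which is bounded both by \<open>2 * sup \<bar>f\<bar>\<close> and by
  \<open>sup \<bar>f'\<bar> * \<bar>x - t\<bar>\<close>, hence by \<open>sqrt (8 * pi) * min \<bar>x - t\<bar> 1\<close>.  Leaving out the \<open>k\<close>-th summand of \<open>S\<close>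
  leaves the variance \<open>1 - \<sigma>\<^sub>k\<^sup>2 / b\<^sub>n\<^sup>2\<close>, and this is how the constant
  \<open>C = sqrt (8 * pi * J / (1 - max (\<sigma>\<^sub>k\<^sup>2 / b\<^sub>n\<^sup>2)))\<close> arises.  The factor \<open>1 / 2\<close> in the total variation
  distance cancels the factor \<open>2\<close> in \<open>2 * C\<close>.

  The densities and the solutions of Stein's equation need not be differentiable everywhere, so all
  calculus is done with \<open>has_RN_derivative\<close>, the fundamental theorem of calculus in integrated form.
\<close>

section \<open>Calculus of integrated derivatives\<close>

lemma has_RN_derivativeI:
  assumes "\<And>a b. a \<le> b \<Longrightarrow> integrable lborel (\<lambda>x. indicator {a..b} x * g x)"
    and "\<And>a b. a \<le> b \<Longrightarrow> f b - f a = (\<integral>x. indicator {a..b} x * g x \<partial>lborel)"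
  shows "has_RN_derivative f g"
  using assms by (simp add: has_RN_derivative_def set_integrable_def set_lebesgue_integral_def)

lemma has_RN_derivative_integrable:
  assumes "has_RN_derivative f g"
  shows "integrable lborel (\<lambda>x. indicator {a..b} x * g x)"
proof (cases "a \<le> b")
  case True
  then show ?thesis
    using assms by (simp add: has_RN_derivative_def set_integrable_def)
qed simp

lemma has_RN_derivative_increment:
  assumes "has_RN_derivative f g" "a \<le> b"
  shows "f b - f a = (\<integral>x. indicator {a..b} x * g x \<partial>lborel)"
  using assms by (simp add: has_RN_derivative_def set_lebesgue_integral_def)

lemma has_RN_derivative_measurable_derivative:
  assumes "has_RN_derivative f g"
  shows "g \<in> borel_measurable borel"
proof (rule borel_measurable_LIMSEQ_real)
  show "(\<lambda>x. indicator {- real i..real i} x * g x) \<in> borel_measurable borel" for i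
    using borel_measurable_integrable[OF has_RN_derivative_integrable[OF assms]] by simp
  show "(\<lambda>i. indicator {- real i..real i} x * g x) \<longlonglongrightarrow> g x" for x
  proof (rule tendsto_eventually)
    obtain n :: nat where "\<bar>x\<bar> \<le> real n" using real_arch_simple by blast
    then have "indicator {- real i..real i} x * g x = g x" if "n \<le> i" for i
      using that by (auto simp: indicator_def abs_le_iff)
    then show "\<forall>\<^sub>F i in sequentially. indicator {- real i..real i} x * g x = g x"
      unfolding eventually_sequentially by blast
  qed
qed

lemma has_RN_derivative_continuous:
  assumes "has_RN_derivative f g"
  shows "continuous_on UNIV f"
proof -
  have "isCont f x" for x
  proof -
    let ?a = "x - 1" and ?b = "x + 1"
    have int: "set_integrable lborel {a..b} g" if "a \<le> b" for a b
      using assms that by (simp add: has_RN_derivative_def)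
    have "continuous_on {?a..?b} (\<lambda>y. integral {?a..y} g)"
      by (intro indefinite_integral_continuous_1 set_borel_integral_eq_integral int) simp
    then have "continuous_on {?a..?b} (\<lambda>y. f ?a + integral {?a..y} g)"
      by (intro continuous_intros)
    moreover have "f ?a + integral {?a..y} g = f y" if "y \<in> {?a..?b}" for y
    proof -
      have y: "?a \<le> y" using that by simp
      then have "f y - f ?a = (LINT z:{?a..y}|lborel. g z)"
        using assms unfolding has_RN_derivative_def by blast
      then show ?thesis
        using set_borel_integral_eq_integral(2)[OF int[OF y]] by simp
    qed
    ultimately have "continuous_on {?a..?b} f"
      by (rule continuous_on_eq)
    then have "continuous_on {?a<..<?b} f"
      by (rule continuous_on_subset) auto
    then show "isCont f x"
      by (simp add: continuous_on_eq_continuous_at)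
  qed
  then show ?thesis
    by (simp add: continuous_at_imp_continuous_on)
qed

lemma has_RN_derivative_measurable:
  "has_RN_derivative f g \<Longrightarrow> f \<in> borel_measurable borel"
  by (intro borel_measurable_continuous_onI has_RN_derivative_continuous)

lemma has_RN_derivative_const: "has_RN_derivative (\<lambda>_. c) (\<lambda>_. 0)"
  by (rule has_RN_derivativeI) simp_all

lemma has_RN_derivative_diff:
  assumes "has_RN_derivative f f'" "has_RN_derivative g g'"
  shows "has_RN_derivative (\<lambda>x. f x - g x) (\<lambda>x. f' x - g' x)"
proof (rule has_RN_derivativeI)
  fix a b :: real
  assume ab: "a \<le> b"
  note int = has_RN_derivative_integrable[OF assms(1), of a b]
    has_RN_derivative_integrable[OF assms(2), of a b]
  show "integrable lborel (\<lambda>x. indicator {a..b} x * (f' x - g' x))"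
    unfolding right_diff_distrib by (intro Bochner_Integration.integrable_diff int)
  show "f b - g b - (f a - g a) = (\<integral>x. indicator {a..b} x * (f' x - g' x) \<partial>lborel)"
    unfolding right_diff_distrib Bochner_Integration.integral_diff[OF int]
      has_RN_derivative_increment[OF assms(1) ab, symmetric]
      has_RN_derivative_increment[OF assms(2) ab, symmetric] by simp
qed

lemma has_RN_derivative_cmult:
  assumes "has_RN_derivative f f'"
  shows "has_RN_derivative (\<lambda>x. c * f x) (\<lambda>x. c * f' x)"
proof (rule has_RN_derivativeI)
  fix a b :: real
  assume ab: "a \<le> b"
  show "integrable lborel (\<lambda>x. indicator {a..b} x * (c * f' x))"
    unfolding mult.left_commute[of _ c]
    by (intro integrable_mult_right has_RN_derivative_integrable[OF assms])
  show "c * f b - c * f a = (\<integral>x. indicator {a..b} x * (c * f' x) \<partial>lborel)"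
    unfolding mult.left_commute[of _ c] integral_mult_right_zero
      has_RN_derivative_increment[OF assms ab, symmetric] by (rule right_diff_distrib[symmetric])
qed

lemma has_RN_derivative_affine:
  assumes f: "has_RN_derivative f f'" and c: "c > 0"
  shows "has_RN_derivative (\<lambda>x. f (t + c * x)) (\<lambda>x. c * f' (t + c * x))"
proof (rule has_RN_derivativeI)
  fix a b :: real
  assume ab: "a \<le> b"
  have ind: "indicator {t + c * a..t + c * b} (t + c * x) = (indicator {a..b} x :: real)" for x
    using c by (simp add: indicator_def)
  have "integrable lborel
      (\<lambda>x. indicator {t + c * a..t + c * b} (t + c * x) * f' (t + c * x))"
    using lborel_integrable_real_affine[OF has_RN_derivative_integrable[OF f], of c] c by simp
  then show "integrable lborel (\<lambda>x. indicator {a..b} x * (c * f' (t + c * x)))"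
    by (simp add: ind mult.left_commute)
  have "f (t + c * b) - f (t + c * a)
      = (\<integral>x. indicator {t + c * a..t + c * b} x * f' x \<partial>lborel)"
    using ab c by (intro has_RN_derivative_increment[OF f]) simp
  also have "\<dots> = c * (\<integral>x. indicator {a..b} x * f' (t + c * x) \<partial>lborel)"
    using c by (subst lborel_integral_real_affine[of c _ t]) (simp_all add: ind)
  finally show "f (t + c * b) - f (t + c * a)
      = (\<integral>x. indicator {a..b} x * (c * f' (t + c * x)) \<partial>lborel)"
    by (simp add: mult.left_commute)
qed

lemma has_RN_derivative_increment_le:
  assumes f: "has_RN_derivative f f'" and B: "\<And>z. z \<in> closed_segment x y \<Longrightarrow> \<bar>f' z\<bar> \<le> B"
  shows "\<bar>f y - f x\<bar> \<le> B * \<bar>y - x\<bar>"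
proof -
  have *: "\<bar>f b - f a\<bar> \<le> B * (b - a)"
    if ab: "a \<le> b" and B: "\<And>z. z \<in> {a..b} \<Longrightarrow> \<bar>f' z\<bar> \<le> B" for a b
  proof -
    have "\<bar>f b - f a\<bar> \<le> (\<integral>z. \<bar>indicator {a..b} z * f' z\<bar> \<partial>lborel)"
      by (simp add: has_RN_derivative_increment[OF f ab] integral_abs_bound)
    also have "\<dots> \<le> (\<integral>z. indicator {a..b} z * B \<partial>lborel)"
    proof (rule integral_mono)
      show "integrable lborel (\<lambda>z. \<bar>indicator {a..b} z * f' z\<bar>)"
        using has_RN_derivative_integrable[OF f] by simp
      show "\<bar>indicator {a..b} z * f' z\<bar> \<le> indicator {a..b} z * B" for z
        using B[of z] by (simp add: indicator_def)
    qed (intro integrable_mult_left integrable_real_indicator, simp_all add: emeasure_lborel_Icc_eq)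
    also have "\<dots> = B * (b - a)"
      using ab by simp
    finally show ?thesis .
  qed
  show ?thesis
    using *[of x y] *[of y x] B
    by (cases "x \<le> y") (auto simp: closed_segment_eq_real_ivl abs_minus_commute)
qed

lemma integrable_pair_mult:
  fixes u v :: "real \<Rightarrow> real"
  assumes [measurable]: "integrable lborel u" "integrable lborel v"
  shows "integrable (lborel \<Otimes>\<^sub>M lborel) (\<lambda>(x, y). u x * v y)"
proof (rule lborel_pair.Fubini_integrable)
  show "integrable lborel (\<lambda>x. \<integral>y. norm (case (x, y) of (x, y) \<Rightarrow> u x * v y) \<partial>lborel)"
    using assms by (simp add: abs_mult)
  show "AE x in lborel. integrable lborel (\<lambda>y. case (x, y) of (x, y) \<Rightarrow> u x * v y)"
    using assms by simp
qed measurable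

text \<open>
  The product of the two increments over \<open>[a, b]\<close> is an integral of \<open>f' y * g' x\<close> over the square.
  Cutting the square along its diagonal and integrating each triangle first in the direction that
  starts at \<open>a\<close> gives the integrals of \<open>(f - f a) * g'\<close> and \<open>(g - g a) * f'\<close>.
\<close>

lemma has_RN_derivative_mult:
  assumes f: "has_RN_derivative f f'" and g: "has_RN_derivative g g'"
  shows "has_RN_derivative (\<lambda>x. f x * g x) (\<lambda>x. f' x * g x + f x * g' x)"
proof (rule has_RN_derivativeI)
  fix a b :: real
  assume ab: "a \<le> b"
  define u where "u x = indicator {a..b} x * f' x" for x
  define v where "v x = indicator {a..b} x * g' x" for x
  have u: "integrable lborel u" and v: "integrable lborel v"
    unfolding u_def v_def using f g by (auto intro: has_RN_derivative_integrable)
  note [measurable] = borel_measurable_integrable[OF u] borel_measurable_integrable[OF v]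
  have Iu: "(\<integral>x. u x \<partial>lborel) = f b - f a" and Iv: "(\<integral>x. v x \<partial>lborel) = g b - g a"
    unfolding u_def v_def
    using has_RN_derivative_increment[OF f ab] has_RN_derivative_increment[OF g ab] by simp_all
  (* the indicator of the lower triangle of the square *)
  define D where "D x y = (if y \<le> x then 1 else 0 :: real)" for x y :: real
  have [measurable]: "(\<lambda>(x, y). D x y) \<in> borel_measurable (lborel \<Otimes>\<^sub>M lborel)"
    unfolding D_def by measurable
  have vu: "integrable (lborel \<Otimes>\<^sub>M lborel) (\<lambda>(x, y). v x * u y)"
    by (rule integrable_pair_mult[OF v u])
  have lower: "integrable (lborel \<Otimes>\<^sub>M lborel) (\<lambda>(x, y). v x * u y * D x y)"
  proof (rule Bochner_Integration.integrable_bound[OF vu])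
    show "(\<lambda>(x, y). v x * u y * D x y) \<in> borel_measurable (lborel \<Otimes>\<^sub>M lborel)"
      by measurable
  qed (simp add: D_def split_beta')
  have upper: "integrable (lborel \<Otimes>\<^sub>M lborel) (\<lambda>(x, y). v x * u y * (1 - D x y))"
  proof (rule Bochner_Integration.integrable_bound[OF vu])
    show "(\<lambda>(x, y). v x * u y * (1 - D x y)) \<in> borel_measurable (lborel \<Otimes>\<^sub>M lborel)"
      by measurable
  qed (simp add: D_def split_beta')
  have lower_fst: "(\<integral>y. v x * u y * D x y \<partial>lborel) = v x * (f x - f a)" for x
  proof (cases "x \<in> {a..b}")
    case True
    then have "u y * D x y = indicator {a..x} y * f' y" for y
      unfolding u_def D_def by (cases "y \<in> {a..x}") auto
    then have "(\<integral>y. u y * D x y \<partial>lborel) = (\<integral>y. indicator {a..x} y * f' y \<partial>lborel)"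
      by simp
    then show ?thesis
      using True has_RN_derivative_increment[OF f, of a x] by (simp add: mult.assoc)
  qed (simp add: v_def)
  have upper_snd: "(\<integral>x. v x * u y * (1 - D x y) \<partial>lborel) = u y * (g y - g a)" for y
  proof (cases "y \<in> {a..b}")
    case True
    have "(\<integral>x. v x * (1 - D x y) \<partial>lborel) = (\<integral>x. indicator {a..y} x * g' x \<partial>lborel)"
    proof (rule integral_cong_AE)
      show "AE x in lborel. v x * (1 - D x y) = indicator {a..y} x * g' x"
        using AE_lborel_singleton[of y]
      proof eventually_elim
        case (elim x)
        then show ?case
          using True unfolding v_def D_def by (cases "x \<in> {a..y}") auto
      qed
    qed (use has_RN_derivative_measurable_derivative[OF g] in \<open>simp_all add: D_def\<close>)
    moreover have "(\<integral>x. v x * u y * (1 - D x y) \<partial>lborel)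
        = (\<integral>x. u y * (v x * (1 - D x y)) \<partial>lborel)"
      by (simp add: mult_ac)
    ultimately show ?thesis
      using True has_RN_derivative_increment[OF g, of a y] by simp
  qed (simp add: u_def)
  have int1: "integrable lborel (\<lambda>x. v x * (f x - f a))"
    using lborel_pair.integrable_fst[OF lower] by (simp add: lower_fst)
  have int2: "integrable lborel (\<lambda>y. u y * (g y - g a))"
    using lborel_pair.integrable_snd[OF upper] by (simp add: upper_snd)
  have "(\<integral>x. v x * (f x - f a) \<partial>lborel) + (\<integral>y. u y * (g y - g a) \<partial>lborel)
      = (\<integral>(x, y). v x * u y * D x y \<partial>(lborel \<Otimes>\<^sub>M lborel))
        + (\<integral>(x, y). v x * u y * (1 - D x y) \<partial>(lborel \<Otimes>\<^sub>M lborel))"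
    using lborel_pair.integral_fst[OF lower] lborel_pair.integral_snd[OF upper]
    by (simp add: lower_fst upper_snd)
  also have "\<dots> = (\<integral>(x, y). v x * u y \<partial>(lborel \<Otimes>\<^sub>M lborel))"
    using lower upper
    by (subst Bochner_Integration.integral_add[symmetric])
       (auto simp: algebra_simps split_beta' intro!: Bochner_Integration.integral_cong)
  also have "\<dots> = (\<integral>x. v x \<partial>lborel) * (\<integral>y. u y \<partial>lborel)"
    using lborel_pair.integral_fst[OF vu] by simp
  finally have eq: "(\<integral>x. v x * (f x - f a) \<partial>lborel) + (\<integral>y. u y * (g y - g a) \<partial>lborel)
      = (g b - g a) * (f b - f a)"
    by (simp add: Iu Iv)
  have split: "indicator {a..b} x * (f' x * g x + f x * g' x)
      = v x * (f x - f a) + u x * (g x - g a) + (f a * v x + g a * u x)" for x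
    by (simp add: u_def v_def algebra_simps)
  show "integrable lborel (\<lambda>x. indicator {a..b} x * (f' x * g x + f x * g' x))"
    unfolding split using int1 int2 u v by simp
  show "f b * g b - f a * g a
      = (\<integral>x. indicator {a..b} x * (f' x * g x + f x * g' x) \<partial>lborel)"
  proof -
    have "(\<integral>x. v x * (f x - f a) + u x * (g x - g a) + (f a * v x + g a * u x) \<partial>lborel)
        = (\<integral>x. v x * (f x - f a) \<partial>lborel) + (\<integral>x. u x * (g x - g a) \<partial>lborel)
          + (f a * (\<integral>x. v x \<partial>lborel) + g a * (\<integral>x. u x \<partial>lborel))"
      using int1 int2 u v by (simp del: right_diff_distrib)
    then show ?thesis
      unfolding split eq Iu Iv by (simp add: algebra_simps)
  qed
qed

lemma has_RN_derivative_power: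
  assumes "has_RN_derivative f f'"
  shows "has_RN_derivative (\<lambda>x. f x ^ Suc m) (\<lambda>x. real (Suc m) * f x ^ m * f' x)"
proof (induction m)
  case (Suc m)
  have eq: "f' x * f x ^ Suc m + f x * (real (Suc m) * f x ^ m * f' x)
      = real (Suc (Suc m)) * f x ^ Suc m * f' x" for x
    by (simp add: algebra_simps)
  show ?case
    using has_RN_derivative_mult[OF assms Suc.IH] by (simp only: eq power_Suc[symmetric])
qed (use assms in simp)

lemma has_RN_derivative_C1:
  assumes "\<And>x. (f has_real_derivative f' x) (at x)" "continuous_on UNIV f'"
  shows "has_RN_derivative f f'"
proof (rule has_RN_derivativeI)
  fix a b :: real
  assume ab: "a \<le> b"
  have cont: "continuous_on {a..b} f'"
    using assms(2) continuous_on_subset by blast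
  show "integrable lborel (\<lambda>x. indicator {a..b} x * f' x)"
    using borel_integrable_atLeastAtMost'[OF cont] by (simp add: set_integrable_def)
  have deriv: "(f has_vector_derivative f' x) (at x within {a..b})" for x
    using assms(1) by (simp add: has_real_derivative_iff_has_vector_derivative
        has_vector_derivative_at_within)
  show "f b - f a = (\<integral>x. indicator {a..b} x * f' x \<partial>lborel)"
    using integral_FTC_atLeastAtMost[OF ab deriv cont] by simp
qed

text \<open>
  The Fisher information sees \<open>p'\<close> only where \<open>p\<close> is positive, so \<open>p'\<close> must carry no mass on the zero
  set of \<open>p\<close>.  With \<open>p \<le> C\<close> on \<open>[a, b]\<close> and \<open>r = 1 - p / C\<close>, the powers \<open>r ^ m\<close> decrease to the indicator
  of this zero set, while the integral of \<open>r ^ m * p'\<close> is explicitly a multiple of an increment of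
  \<open>r ^ (m + 1) / (m + 1)\<close> and hence tends to \<open>0\<close>.
\<close>

lemma has_RN_derivative_restrict_pos:
  assumes p: "has_RN_derivative p p'" and nonneg: "\<And>x. 0 \<le> p x"
  shows "has_RN_derivative p (\<lambda>x. indicator {x. 0 < p x} x * p' x)"
proof (rule has_RN_derivativeI)
  fix a b :: real
  assume ab: "a \<le> b"
  have [measurable]: "p \<in> borel_measurable borel" "p' \<in> borel_measurable borel"
    using p by (auto intro: has_RN_derivative_measurable has_RN_derivative_measurable_derivative)
  have int: "integrable lborel (\<lambda>x. indicator {a..b} x * p' x)"
    by (rule has_RN_derivative_integrable[OF p])
  have "compact (p ` {a..b})"
    using has_RN_derivative_continuous[OF p]
    by (intro compact_continuous_image) (auto intro: continuous_on_subset)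
  then obtain C where C: "C > 0" "\<And>x. x \<in> {a..b} \<Longrightarrow> norm (p x) \<le> C"
    using compact_imp_bounded bounded_pos by (metis imageI)
  define r where "r x = 1 - p x / C" for x
  have r: "has_RN_derivative r (\<lambda>x. - p' x / C)"
    using has_RN_derivative_diff[OF has_RN_derivative_const[of 1] has_RN_derivative_cmult[OF p, of "1 / C"]]
    by (simp add: r_def[abs_def])
  have r01: "0 \<le> r x" "r x \<le> 1" if "x \<in> {a..b}" for x
    using C(1) C(2)[of x] nonneg[of x] that by (auto simp: r_def)
  have [measurable]: "r \<in> borel_measurable borel"
    by (rule has_RN_derivative_measurable[OF r])
  have I: "(\<integral>x. indicator {a..b} x * (r x ^ m * p' x) \<partial>lborel)
      = - C / real (Suc m) * (r b ^ Suc m - r a ^ Suc m)" for m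
  proof -
    have "r b ^ Suc m - r a ^ Suc m
        = (\<integral>x. (- real (Suc m) / C) * (indicator {a..b} x * (r x ^ m * p' x)) \<partial>lborel)"
      unfolding has_RN_derivative_increment[OF has_RN_derivative_power[OF r] ab]
      using C(1) by (intro Bochner_Integration.integral_cong) (auto simp: field_simps)
    also have "\<dots> = (- real (Suc m) / C)
        * (\<integral>x. indicator {a..b} x * (r x ^ m * p' x) \<partial>lborel)"
      by (rule integral_mult_right_zero)
    finally show ?thesis
      using C(1) by (simp add: field_simps)
  qed
  have "(\<lambda>m. \<integral>x. indicator {a..b} x * (r x ^ m * p' x) \<partial>lborel)
      \<longlonglongrightarrow> (\<integral>x. indicator {x. p x = 0} x * (indicator {a..b} x * p' x) \<partial>lborel)"
  proof (rule integral_dominated_convergence)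
    show "integrable lborel (\<lambda>x. \<bar>indicator {a..b} x * p' x\<bar>)"
      using int by simp
    show "AE x in lborel. (\<lambda>m. indicator {a..b} x * (r x ^ m * p' x))
        \<longlonglongrightarrow> indicator {x. p x = 0} x * (indicator {a..b} x * p' x)"
    proof (rule AE_I2)
      fix x
      consider "x \<notin> {a..b}" | "x \<in> {a..b}" "p x = 0" | "x \<in> {a..b}" "p x > 0"
        using nonneg[of x] by fastforce
      then show "(\<lambda>m. indicator {a..b} x * (r x ^ m * p' x))
          \<longlonglongrightarrow> indicator {x. p x = 0} x * (indicator {a..b} x * p' x)"
      proof cases
        case 3
        then have "r x < 1" using C(1) by (simp add: r_def)
        then have "(\<lambda>m. r x ^ m) \<longlonglongrightarrow> 0"
          using r01[of x] 3 by (intro LIMSEQ_power_zero) auto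
        then have "(\<lambda>m. r x ^ m * p' x) \<longlonglongrightarrow> 0"
          by (rule tendsto_mult_left_zero)
        then show ?thesis using 3 by simp
      qed (simp_all add: r_def)
    qed
    show "AE x in lborel. norm (indicator {a..b} x * (r x ^ m * p' x))
        \<le> \<bar>indicator {a..b} x * p' x\<bar>" for m
      using r01 by (intro AE_I2)
        (auto simp: indicator_def abs_mult intro!: mult_left_le_one_le power_le_one)
  qed measurable
  moreover have "(\<lambda>m. \<integral>x. indicator {a..b} x * (r x ^ m * p' x) \<partial>lborel) \<longlonglongrightarrow> 0"
  proof (rule Lim_null_comparison)
    show "\<forall>\<^sub>F m in sequentially.
        norm (\<integral>x. indicator {a..b} x * (r x ^ m * p' x) \<partial>lborel) \<le> C / real (Suc m)"
    proof (rule always_eventually, rule allI)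
      fix m
      have "0 \<le> r b ^ Suc m" "r b ^ Suc m \<le> 1" "0 \<le> r a ^ Suc m" "r a ^ Suc m \<le> 1"
        using r01[of a] r01[of b] ab by (auto intro!: power_le_one zero_le_power simp del: power_Suc)
      then have "\<bar>r b ^ Suc m - r a ^ Suc m\<bar> \<le> 1" by linarith
      then have "C / real (Suc m) * \<bar>r b ^ Suc m - r a ^ Suc m\<bar> \<le> C / real (Suc m)"
        using C(1) by (intro mult_left_le) auto
      then show "norm (\<integral>x. indicator {a..b} x * (r x ^ m * p' x) \<partial>lborel) \<le> C / real (Suc m)"
        unfolding I using C(1) by (simp add: abs_mult del: power_Suc of_nat_Suc)
    qed
    show "(\<lambda>m. C / real (Suc m)) \<longlonglongrightarrow> 0"
      using LIMSEQ_Suc[OF lim_const_over_n] by blast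
  qed
  ultimately have zero: "(\<integral>x. indicator {x. p x = 0} x * (indicator {a..b} x * p' x) \<partial>lborel) = 0"
    using LIMSEQ_unique by blast
  have intA: "integrable lborel (\<lambda>x. indicator A x * (indicator {a..b} x * p' x))"
    if [measurable]: "A \<in> sets borel" for A
    using integrable_mult_indicator[OF _ int, of A] by simp
  have eq: "indicator {a..b} x * (indicator {x. 0 < p x} x * p' x)
      = indicator {x. 0 < p x} x * (indicator {a..b} x * p' x)" for x
    by simp
  show "integrable lborel (\<lambda>x. indicator {a..b} x * (indicator {x. 0 < p x} x * p' x))"
    unfolding eq by (rule intA) measurable
  have "p b - p a = (\<integral>x. indicator {x. 0 < p x} x * (indicator {a..b} x * p' x)
      + indicator {x. p x = 0} x * (indicator {a..b} x * p' x) \<partial>lborel)"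
    unfolding has_RN_derivative_increment[OF p ab]
    by (intro Bochner_Integration.integral_cong) (use nonneg in \<open>auto simp: indicator_def less_le\<close>)
  also have "\<dots> = (\<integral>x. indicator {x. 0 < p x} x * (indicator {a..b} x * p' x) \<partial>lborel)"
    by (subst Bochner_Integration.integral_add) (auto simp: zero intro!: intA)
  finally show "p b - p a = (\<integral>x. indicator {a..b} x * (indicator {x. 0 < p x} x * p' x) \<partial>lborel)"
    unfolding eq .
qed

section \<open>Integration by parts on the line\<close>

text \<open>
  On a unit interval a value of \<open>u\<close> differs from its average by at most the total variation.  For
  integrable \<open>u\<close> and \<open>u'\<close> this forces \<open>u\<close> to vanish at infinity.
\<close>

lemma has_RN_derivative_le_integral:
  assumes u: "has_RN_derivative u u'" and int: "integrable lborel u" "integrable lborel u'"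
  shows "\<bar>u a\<bar> \<le> (\<integral>x. indicator {a..a + 1} x * (\<bar>u x\<bar> + \<bar>u' x\<bar>) \<partial>lborel)"
proof -
  have int_abs: "integrable lborel (\<lambda>x. indicator {a..b} x * \<bar>v x\<bar>)" if "integrable lborel v"
    for v :: "real \<Rightarrow> real" and b
    using integrable_mult_indicator[OF _ integrable_abs[OF that], of "{a..b}"] by simp
  define K where "K = (\<integral>x. indicator {a..a + 1} x * \<bar>u' x\<bar> \<partial>lborel)"
  have bound: "\<bar>u a\<bar> \<le> \<bar>u x\<bar> + K" if x: "x \<in> {a..a + 1}" for x
  proof -
    have "\<bar>u x - u a\<bar> \<le> (\<integral>y. \<bar>indicator {a..x} y * u' y\<bar> \<partial>lborel)"
      using x by (simp add: has_RN_derivative_increment[OF u] integral_abs_bound)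
    also have "\<dots> \<le> K"
      unfolding K_def
    proof (rule integral_mono)
      show "integrable lborel (\<lambda>y. \<bar>indicator {a..x} y * u' y\<bar>)"
        using int_abs[OF int(2), of x] by (simp add: abs_mult)
      show "\<bar>indicator {a..x} y * u' y\<bar> \<le> indicator {a..a + 1} y * \<bar>u' y\<bar>" for y
        using x by (simp add: indicator_def)
    qed (rule int_abs[OF int(2)])
    finally show ?thesis by linarith
  qed
  have const: "integrable lborel (\<lambda>x. indicator {a..a + 1} x * c)" for c :: real
    by (intro integrable_mult_left integrable_real_indicator) (simp_all add: emeasure_lborel_Icc_eq)
  have "\<bar>u a\<bar> = (\<integral>x. indicator {a..a + 1} x * \<bar>u a\<bar> \<partial>lborel)"
    by simp
  also have "\<dots> \<le> (\<integral>x. indicator {a..a + 1} x * \<bar>u x\<bar> + indicator {a..a + 1} x * K \<partial>lborel)"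
  proof (rule integral_mono[OF const])
    show "integrable lborel (\<lambda>x. indicator {a..a + 1} x * \<bar>u x\<bar> + indicator {a..a + 1} x * K)"
      by (intro Bochner_Integration.integrable_add int_abs[OF int(1)] const)
    show "indicator {a..a + 1} x * \<bar>u a\<bar>
        \<le> indicator {a..a + 1} x * \<bar>u x\<bar> + indicator {a..a + 1} x * K" for x
      using bound[of x] by (simp add: indicator_def)
  qed
  also have "\<dots> = (\<integral>x. indicator {a..a + 1} x * \<bar>u x\<bar> \<partial>lborel) + K"
    by (subst Bochner_Integration.integral_add[OF int_abs[OF int(1)] const]) simp
  also have "\<dots> = (\<integral>x. indicator {a..a + 1} x * (\<bar>u x\<bar> + \<bar>u' x\<bar>) \<partial>lborel)"
    unfolding K_def distrib_left
    by (rule Bochner_Integration.integral_add[symmetric, OF int_abs[OF int(1)] int_abs[OF int(2)]])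
  finally show ?thesis .
qed

lemma has_RN_derivative_tendsto_0:
  assumes u: "has_RN_derivative u u'" and int: "integrable lborel u" "integrable lborel u'"
    and c: "filterlim (\<lambda>n. \<bar>c n\<bar>) at_top sequentially"
  shows "(\<lambda>n. u (c n)) \<longlonglongrightarrow> 0"
proof (rule Lim_null_comparison)
  let ?w = "\<lambda>x. \<bar>u x\<bar> + \<bar>u' x\<bar>"
  show "\<forall>\<^sub>F n in sequentially.
      norm (u (c n)) \<le> (\<integral>x. indicator {c n..c n + 1} x * ?w x \<partial>lborel)"
    using has_RN_derivative_le_integral[OF u int] by (intro always_eventually) auto
  note [measurable] = borel_measurable_integrable[OF int(1)] borel_measurable_integrable[OF int(2)]
  have "(\<lambda>n. \<integral>x. indicator {c n..c n + 1} x * ?w x \<partial>lborel) \<longlonglongrightarrow> (\<integral>x. 0 \<partial>(lborel :: real measure))"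
  proof (rule integral_dominated_convergence)
    show "integrable lborel ?w"
      using int by simp
    show "AE x in lborel. (\<lambda>n. indicator {c n..c n + 1} x * ?w x) \<longlonglongrightarrow> 0"
    proof (rule AE_I2)
      fix x
      have "\<forall>\<^sub>F n in sequentially. \<bar>x\<bar> + 1 < \<bar>c n\<bar>"
        using c by (simp add: filterlim_at_top_dense)
      then have "\<forall>\<^sub>F n in sequentially. indicator {c n..c n + 1} x * ?w x = 0"
        by eventually_elim (auto simp: indicator_def)
      then show "(\<lambda>n. indicator {c n..c n + 1} x * ?w x) \<longlonglongrightarrow> 0"
        by (rule tendsto_eventually)
    qed
    show "AE x in lborel. norm (indicator {c n..c n + 1} x * ?w x) \<le> ?w x" for n
      by (intro AE_I2) (simp add: indicator_def)
  qed measurable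
  then show "(\<lambda>n. \<integral>x. indicator {c n..c n + 1} x * ?w x \<partial>lborel) \<longlonglongrightarrow> 0"
    by simp
qed

lemma integral_RN_derivative_eq_0:
  assumes u: "has_RN_derivative u u'" and int: "integrable lborel u" "integrable lborel u'"
  shows "(\<integral>x. u' x \<partial>lborel) = 0"
proof (rule LIMSEQ_unique)
  note [measurable] = borel_measurable_integrable[OF int(2)]
  show "(\<lambda>n. \<integral>x. indicator {- real n..real n} x * u' x \<partial>lborel) \<longlonglongrightarrow> (\<integral>x. u' x \<partial>lborel)"
  proof (rule integral_dominated_convergence)
    show "integrable lborel (\<lambda>x. \<bar>u' x\<bar>)"
      using int by simp
    show "AE x in lborel. (\<lambda>n. indicator {- real n..real n} x * u' x) \<longlonglongrightarrow> u' x"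
    proof (rule AE_I2)
      fix x
      obtain N :: nat where "\<bar>x\<bar> \<le> real N" using real_arch_simple by blast
      then have "indicator {- real n..real n} x * u' x = u' x" if "N \<le> n" for n
        using that by (simp add: indicator_def abs_le_iff)
      then show "(\<lambda>n. indicator {- real n..real n} x * u' x) \<longlonglongrightarrow> u' x"
        by (intro tendsto_eventually) (auto simp: eventually_sequentially)
    qed
    show "AE x in lborel. norm (indicator {- real n..real n} x * u' x) \<le> \<bar>u' x\<bar>" for n
      by (intro AE_I2) (simp add: indicator_def)
  qed measurable
  have eq: "(\<integral>x. indicator {- real n..real n} x * u' x \<partial>lborel) = u (real n) - u (- real n)" for n
    by (rule has_RN_derivative_increment[OF u, symmetric]) simp
  have "(\<lambda>n. u (real n) - u (- real n)) \<longlonglongrightarrow> 0 - 0"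
    using filterlim_real_sequentially
    by (intro tendsto_diff has_RN_derivative_tendsto_0[OF u int]) simp_all
  then show "(\<lambda>n. \<integral>x. indicator {- real n..real n} x * u' x \<partial>lborel) \<longlonglongrightarrow> 0"
    unfolding eq by simp
qed

lemma integral_by_parts_bounded:
  assumes p: "has_RN_derivative p p'" and int: "integrable lborel p" "integrable lborel p'"
    and g: "has_RN_derivative g g'" and B: "\<And>x. \<bar>g x\<bar> \<le> B" "\<And>x. \<bar>g' x\<bar> \<le> B'"
  shows "(\<integral>x. p x * g' x \<partial>lborel) = - (\<integral>x. p' x * g x \<partial>lborel)"
proof -
  have [measurable]: "g \<in> borel_measurable borel" "g' \<in> borel_measurable borel"
    using g by (auto intro: has_RN_derivative_measurable has_RN_derivative_measurable_derivative)
  have mult: "integrable lborel (\<lambda>x. v x * w x)"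
    if v: "integrable lborel v" and [measurable]: "w \<in> borel_measurable borel"
      and w: "\<And>x. \<bar>w x\<bar> \<le> C"
    for v w :: "real \<Rightarrow> real" and C
  proof (rule Bochner_Integration.integrable_bound)
    show "integrable lborel (\<lambda>x. C * v x)" using v by simp
    show "AE x in lborel. norm (v x * w x) \<le> norm (C * v x)"
    proof (rule AE_I2)
      fix x
      have "\<bar>w x\<bar> \<le> \<bar>C\<bar>" using w[of x] by linarith
      then show "norm (v x * w x) \<le> norm (C * v x)"
        by (simp add: abs_mult mult.commute[of "\<bar>C\<bar>"] mult_left_mono)
    qed
  qed (use borel_measurable_integrable[OF v] in measurable)
  note int' = mult[OF int(1) _ B(2)] mult[OF int(2) _ B(1)] mult[OF int(1) _ B(1)]
  have "(\<integral>x. p' x * g x + p x * g' x \<partial>lborel) = 0"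
    by (rule integral_RN_derivative_eq_0[OF has_RN_derivative_mult[OF p g]])
       (auto intro!: int' Bochner_Integration.integrable_add)
  then show ?thesis
    using int' by simp
qed

section \<open>Independent random variables\<close>

text \<open>
  Fubini's theorem for an independent pair, with the inner expectation taken over \<open>M\<close> itself rather
  than over a law on the line, so that results about a single random variable apply to it directly.
\<close>

lemma (in prob_space) expectation_indep_pair:
  fixes h :: "real \<times> real \<Rightarrow> real"
  assumes ind: "indep_var borel X borel Y" and [measurable]: "h \<in> borel_measurable borel"
    and int: "integrable M (\<lambda>w. h (X w, Y w))"
  shows "expectation (\<lambda>w. h (X w, Y w)) = expectation (\<lambda>v. expectation (\<lambda>w. h (X w, Y v)))"
    and "integrable M (\<lambda>v. expectation (\<lambda>w. h (X w, Y v)))"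
proof -
  have [measurable]: "random_variable borel X" "random_variable borel Y"
    and pair: "distr M borel X \<Otimes>\<^sub>M distr M borel Y = distr M (borel \<Otimes>\<^sub>M borel) (\<lambda>w. (X w, Y w))"
    using ind by (auto simp: indep_var_distribution_eq)
  have h[measurable]: "h \<in> borel_measurable (borel \<Otimes>\<^sub>M borel)"
    by (simp add: borel_prod)
  interpret DX: prob_space "distr M borel X" by (rule prob_space_distr) simp
  interpret DY: prob_space "distr M borel Y" by (rule prob_space_distr) simp
  interpret P: pair_prob_space "distr M borel X" "distr M borel Y" ..
  have int2: "integrable (distr M borel X \<Otimes>\<^sub>M distr M borel Y) (\<lambda>(x, y). h (x, y))"
    unfolding pair using int by (simp add: integrable_distr_eq)
  have inner: "(\<integral>x. h (x, y) \<partial>distr M borel X) = expectation (\<lambda>w. h (X w, y))" for y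
    by (subst integral_distr) auto
  have "(\<lambda>(y, x). h (x, y)) \<in> borel_measurable (borel \<Otimes>\<^sub>M distr M borel X)"
    by measurable
  then have [measurable]: "(\<lambda>y. expectation (\<lambda>w. h (X w, y))) \<in> borel_measurable borel"
    using DX.borel_measurable_lebesgue_integral[of "\<lambda>y x. h (x, y)" borel] by (simp add: inner)
  have "expectation (\<lambda>w. h (X w, Y w)) = integral\<^sup>L (distr M borel X \<Otimes>\<^sub>M distr M borel Y) h"
    unfolding pair by (subst integral_distr) auto
  also have "\<dots> = (\<integral>y. (\<integral>x. h (x, y) \<partial>distr M borel X) \<partial>distr M borel Y)"
    using P.integral_snd[OF int2] by simp
  also have "\<dots> = expectation (\<lambda>v. expectation (\<lambda>w. h (X w, Y v)))"
    unfolding inner by (subst integral_distr) auto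
  finally show "expectation (\<lambda>w. h (X w, Y w)) = expectation (\<lambda>v. expectation (\<lambda>w. h (X w, Y v)))" .
  have "integrable (distr M borel Y) (\<lambda>y. expectation (\<lambda>w. h (X w, y)))"
    using P.integrable_snd[OF int2] by (simp add: inner)
  then show "integrable M (\<lambda>v. expectation (\<lambda>w. h (X w, Y v)))"
    by (simp add: integrable_distr_eq)
qed

lemma (in prob_space) expectation_abs_le_sqrt:
  fixes Z :: "'a \<Rightarrow> real"
  assumes [measurable]: "random_variable borel Z" and sq: "integrable M (\<lambda>w. (Z w)\<^sup>2)"
  shows "expectation (\<lambda>w. \<bar>Z w\<bar>) \<le> sqrt (expectation (\<lambda>w. (Z w)\<^sup>2))"
proof -
  have "integrable M (\<lambda>w. \<bar>Z w\<bar>)"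
    using square_integrable_imp_integrable[OF _ sq] by simp
  then have "0 \<le> expectation (\<lambda>w. (Z w)\<^sup>2) - (expectation (\<lambda>w. \<bar>Z w\<bar>))\<^sup>2"
    using variance_eq[of "\<lambda>w. \<bar>Z w\<bar>"] variance_positive[of "\<lambda>w. \<bar>Z w\<bar>"] sq by simp
  then show ?thesis
    by (intro real_le_rsqrt) simp
qed

lemma (in prob_space) expectation_sum_sq_indep:
  fixes Z :: "'i \<Rightarrow> 'a \<Rightarrow> real"
  assumes "finite I" "indep_vars (\<lambda>_. borel) Z I"
    and "\<And>i. i \<in> I \<Longrightarrow> integrable M (\<lambda>w. (Z i w)\<^sup>2)"
    and "\<And>i. i \<in> I \<Longrightarrow> expectation (Z i) = 0"
  shows "integrable M (\<lambda>w. (\<Sum>i\<in>I. Z i w)\<^sup>2)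
    \<and> expectation (\<lambda>w. (\<Sum>i\<in>I. Z i w)\<^sup>2) = (\<Sum>i\<in>I. expectation (\<lambda>w. (Z i w)\<^sup>2))"
  using assms
proof (induction I rule: finite_induct)
  case (insert i I)
  let ?T = "\<lambda>w. \<Sum>i\<in>I. Z i w"
  have rv: "random_variable borel (Z j)" if "j \<in> insert i I" for j
    using insert.prems(1) that by (auto simp: indep_vars_def)
  have IH: "integrable M (\<lambda>w. (?T w)\<^sup>2)"
    "expectation (\<lambda>w. (?T w)\<^sup>2) = (\<Sum>i\<in>I. expectation (\<lambda>w. (Z i w)\<^sup>2))"
    using insert.IH insert.prems indep_vars_subset[OF insert.prems(1), of I] by auto
  have ind: "indep_var borel (Z i) borel ?T"
    by (rule indep_vars_sum[OF insert.hyps insert.prems(1)])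
  have sq: "integrable M (\<lambda>w. (Z i w)\<^sup>2)"
    by (rule insert.prems(2)) simp
  have int: "integrable M (Z i)" "integrable M ?T"
    using square_integrable_imp_integrable[OF _ sq] square_integrable_imp_integrable[OF _ IH(1)] rv
    by auto
  note prod = indep_var_integrable[OF ind int] indep_var_lebesgue_integral[OF ind int]
  have zero: "expectation (Z i) = 0"
    by (rule insert.prems(3)) simp
  have eq: "(\<Sum>j\<in>insert i I. Z j w)\<^sup>2 = (Z i w)\<^sup>2 + (?T w)\<^sup>2 + 2 * (Z i w * ?T w)" for w
    using insert.hyps by (simp add: power2_sum)
  show ?case
    unfolding eq using sq IH prod zero insert.hyps by simp
qed simp

section \<open>Score functions and Fisher information of sums\<close>

text \<open>Division by zero makes the score vanish where the density does.\<close>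

definition score :: "(real \<Rightarrow> real) \<Rightarrow> (real \<Rightarrow> real) \<Rightarrow> real \<Rightarrow> real" where
  "score p p' x = p' x / p x"

lemma distributed_density_integrable:
  fixes X :: "'a \<Rightarrow> real"
  assumes "prob_space M" and d: "distributed M lborel X (\<lambda>x. ennreal (p x))" and nonneg: "\<And>x. 0 \<le> p x"
  shows "integrable lborel p"
proof -
  interpret prob_space M by fact
  show ?thesis
    using distributed_integrable[OF d, of "\<lambda>_. 1"] nonneg by simp
qed

lemma score_measurable:
  assumes "has_RN_derivative p p'"
  shows "score p p' \<in> borel_measurable borel"
  using has_RN_derivative_measurable[OF assms] has_RN_derivative_measurable_derivative[OF assms]
  unfolding score_def[abs_def] by measurable

lemma score_weighted:
  assumes "0 \<le> p x"
  shows "p x * (score p p' x * c) = indicator {x. 0 < p x} x * p' x * c"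
  using assms by (auto simp: score_def indicator_def less_le)

lemma (in prob_space) score_square_integrable:
  fixes X :: "'a \<Rightarrow> real"
  assumes nonneg: "\<And>x. 0 \<le> p x" and d: "distributed M lborel X (\<lambda>x. ennreal (p x))"
    and p: "has_RN_derivative p p'"
    and fin: "(\<integral>\<^sup>+x\<in>{x. 0 < p x}. ennreal ((p' x)\<^sup>2 / p x) \<partial>lborel) < \<infinity>"
  shows "integrable M (\<lambda>w. (score p p' (X w))\<^sup>2)"
    and "expectation (\<lambda>w. (score p p' (X w))\<^sup>2)
      = enn2real (\<integral>\<^sup>+x\<in>{x. 0 < p x}. ennreal ((p' x)\<^sup>2 / p x) \<partial>lborel)"
proof -
  note [measurable] = score_measurable[OF p] has_RN_derivative_measurable[OF p]
    has_RN_derivative_measurable_derivative[OF p]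
  have [measurable]: "random_variable borel X"
    using distributed_measurable[OF d] by simp
  have "(\<integral>\<^sup>+w. ennreal ((score p p' (X w))\<^sup>2) \<partial>M)
      = (\<integral>\<^sup>+x. ennreal (p x) * ennreal ((score p p' x)\<^sup>2) \<partial>lborel)"
    by (rule distributed_nn_integral[OF d, symmetric]) measurable
  also have "\<dots> = (\<integral>\<^sup>+x\<in>{x. 0 < p x}. ennreal ((p' x)\<^sup>2 / p x) \<partial>lborel)"
  proof (rule nn_integral_cong)
    fix x
    show "ennreal (p x) * ennreal ((score p p' x)\<^sup>2)
        = ennreal ((p' x)\<^sup>2 / p x) * indicator {x. 0 < p x} x"
      using nonneg[of x]
      by (auto simp: ennreal_mult[symmetric] score_def indicator_def less_le power2_eq_square)
  qed
  finally have eq: "(\<integral>\<^sup>+w. ennreal ((score p p' (X w))\<^sup>2) \<partial>M)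
      = (\<integral>\<^sup>+x\<in>{x. 0 < p x}. ennreal ((p' x)\<^sup>2 / p x) \<partial>lborel)" .
  have rv: "(\<lambda>w. (score p p' (X w))\<^sup>2) \<in> borel_measurable M"
    by measurable
  show "integrable M (\<lambda>w. (score p p' (X w))\<^sup>2)"
    using fin rv by (intro integrableI_nonneg) (auto simp: eq)
  show "expectation (\<lambda>w. (score p p' (X w))\<^sup>2)
      = enn2real (\<integral>\<^sup>+x\<in>{x. 0 < p x}. ennreal ((p' x)\<^sup>2 / p x) \<partial>lborel)"
    using rv by (simp add: integral_eq_nn_integral eq)
qed

text \<open>
  Integration by parts against the density.  Square integrability of the score makes the derivative
  of the density integrable over the set where the density is positive.
\<close>

lemma (in prob_space) score_identity:
  fixes X :: "'a \<Rightarrow> real"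
  assumes nonneg: "\<And>x. 0 \<le> p x" and d: "distributed M lborel X (\<lambda>x. ennreal (p x))"
    and p: "has_RN_derivative p p'"
    and fin: "(\<integral>\<^sup>+x\<in>{x. 0 < p x}. ennreal ((p' x)\<^sup>2 / p x) \<partial>lborel) < \<infinity>"
    and g: "has_RN_derivative g g'" and B: "\<And>x. \<bar>g x\<bar> \<le> B" "\<And>x. \<bar>g' x\<bar> \<le> B'"
  shows "expectation (\<lambda>w. g' (X w)) = - expectation (\<lambda>w. score p p' (X w) * g (X w))"
proof -
  note [measurable] = score_measurable[OF p] has_RN_derivative_measurable[OF g]
    has_RN_derivative_measurable_derivative[OF g]
  have [measurable]: "random_variable borel X"
    using distributed_measurable[OF d] by simp
  let ?q = "\<lambda>x. indicator {x. 0 < p x} x * p' x"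
  have eq: "p x * (score p p' x * c) = ?q x * c" for x c
    using nonneg[of x] by (rule score_weighted)
  have "integrable M (\<lambda>w. score p p' (X w))"
    by (rule square_integrable_imp_integrable[OF _ score_square_integrable(1)[OF nonneg d p fin]])
       measurable
  then have q: "integrable lborel ?q"
    using distributed_integrable[OF d, of "score p p'"] nonneg eq[of _ 1] by simp
  have "expectation (\<lambda>w. g' (X w)) = (\<integral>x. p x * g' x \<partial>lborel)"
    using nonneg by (intro distributed_integral[OF d, symmetric]) auto
  also have "\<dots> = - (\<integral>x. ?q x * g x \<partial>lborel)"
    using distributed_density_integrable[OF prob_space_axioms d nonneg] q
    by (intro integral_by_parts_bounded[OF has_RN_derivative_restrict_pos[OF p nonneg] _ _ g B])
  also have "\<dots> = - (\<integral>x. p x * (score p p' x * g x) \<partial>lborel)"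
    by (simp only: eq)
  also have "\<dots> = - expectation (\<lambda>w. score p p' (X w) * g (X w))"
    using nonneg by (subst distributed_integral[OF d]) auto
  finally show ?thesis .
qed

lemma (in prob_space) score_identity_indep:
  fixes X :: "'a \<Rightarrow> real"
  assumes nonneg: "\<And>x. 0 \<le> p x" and d: "distributed M lborel X (\<lambda>x. ennreal (p x))"
    and p: "has_RN_derivative p p'"
    and fin: "(\<integral>\<^sup>+x\<in>{x. 0 < p x}. ennreal ((p' x)\<^sup>2 / p x) \<partial>lborel) < \<infinity>"
    and g: "has_RN_derivative g g'" and B: "\<And>x. \<bar>g x\<bar> \<le> B" "\<And>x. \<bar>g' x\<bar> \<le> B'"
    and ind: "indep_var borel X borel Y"
  shows "expectation (\<lambda>w. g' (X w + Y w)) = - expectation (\<lambda>w. score p p' (X w) * g (X w + Y w))"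
    and "integrable M (\<lambda>w. score p p' (X w) * g (X w + Y w))"
proof -
  note [measurable] = score_measurable[OF p] has_RN_derivative_measurable[OF g]
    has_RN_derivative_measurable_derivative[OF g]
  have [measurable]: "random_variable borel X" "random_variable borel Y"
    using ind by (auto simp: indep_var_distribution_eq)
  have score: "integrable M (\<lambda>w. score p p' (X w))"
    by (rule square_integrable_imp_integrable[OF _ score_square_integrable(1)[OF nonneg d p fin]])
       measurable
  have int1: "integrable M (\<lambda>w. g' (X w + Y w))"
    by (rule integrable_const_bound[of _ B']) (auto simp: B)
  show int2: "integrable M (\<lambda>w. score p p' (X w) * g (X w + Y w))"
  proof (rule Bochner_Integration.integrable_bound)
    show "integrable M (\<lambda>w. score p p' (X w) * B)" using score by simp
    show "AE w in M. norm (score p p' (X w) * g (X w + Y w)) \<le> norm (score p p' (X w) * B)"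
    proof (rule AE_I2)
      fix w
      have "\<bar>g (X w + Y w)\<bar> \<le> \<bar>B\<bar>" using B(1)[of "X w + Y w"] by linarith
      then show "norm (score p p' (X w) * g (X w + Y w)) \<le> norm (score p p' (X w) * B)"
        by (simp add: abs_mult mult_left_mono)
    qed
  qed measurable
  have m1: "(\<lambda>(x, y). g' (x + y)) \<in> borel_measurable borel"
    and m2: "(\<lambda>(x, y). score p p' x * g (x + y)) \<in> borel_measurable borel"
    unfolding borel_prod[symmetric] by measurable
  have shift: "expectation (\<lambda>w. g' (X w + y)) = - expectation (\<lambda>w. score p p' (X w) * g (X w + y))" for y
    using score_identity[OF nonneg d p fin has_RN_derivative_affine[OF g zero_less_one, of y],
        of B B'] B by (simp add: add.commute)
  have "expectation (\<lambda>w. g' (X w + Y w)) = expectation (\<lambda>v. expectation (\<lambda>w. g' (X w + Y v)))"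
    using expectation_indep_pair(1)[OF ind m1] int1 by simp
  also have "\<dots> = - expectation (\<lambda>v. expectation (\<lambda>w. score p p' (X w) * g (X w + Y v)))"
    by (simp add: shift)
  also have "\<dots> = - expectation (\<lambda>w. score p p' (X w) * g (X w + Y w))"
    using expectation_indep_pair(1)[OF ind m2] int2 by simp
  finally show "expectation (\<lambda>w. g' (X w + Y w))
      = - expectation (\<lambda>w. score p p' (X w) * g (X w + Y w))" .
qed

text \<open>The constant test function \<open>1\<close> shows that the score is centred.\<close>

lemma (in prob_space) expectation_score_eq_0:
  fixes X :: "'a \<Rightarrow> real"
  assumes nonneg: "\<And>x. 0 \<le> p x" and d: "distributed M lborel X (\<lambda>x. ennreal (p x))"
    and p: "has_RN_derivative p p'"
    and fin: "(\<integral>\<^sup>+x\<in>{x. 0 < p x}. ennreal ((p' x)\<^sup>2 / p x) \<partial>lborel) < \<infinity>"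
  shows "expectation (\<lambda>w. score p p' (X w)) = 0"
  using score_identity[OF nonneg d p fin has_RN_derivative_const[of 1], of 1 0] by simp

text \<open>
  Each summand offers its own score for the integration by parts, hence so does any weighted average
  of the scores.  Centred independent scores are orthogonal, and the \<open>i\<close>-th one has second moment at
  most \<open>J / s i\<close>.  If all these bounds are attained, then the weights \<open>s i / sum s I\<close> minimise the
  second moment of the average; the minimum is \<open>J / sum s I\<close>.
\<close>

lemma (in prob_space) expectation_derivative_sum_le:
  fixes X :: "'i \<Rightarrow> 'a \<Rightarrow> real" and s :: "'i \<Rightarrow> real"
  assumes I: "finite I" "I \<noteq> {}" and ind: "indep_vars (\<lambda>_. borel) X I"
    and nonneg: "\<And>i x. i \<in> I \<Longrightarrow> 0 \<le> p i x"
    and d: "\<And>i. i \<in> I \<Longrightarrow> distributed M lborel (X i) (\<lambda>x. ennreal (p i x))"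
    and p: "\<And>i. i \<in> I \<Longrightarrow> has_RN_derivative (p i) (p' i)"
    and fin: "\<And>i. i \<in> I \<Longrightarrow>
      (\<integral>\<^sup>+x\<in>{x. 0 < p i x}. ennreal ((p' i x)\<^sup>2 / p i x) \<partial>lborel) < \<infinity>"
    and s: "\<And>i. i \<in> I \<Longrightarrow> 0 < s i"
    and J: "\<And>i. i \<in> I \<Longrightarrow>
      s i * enn2real (\<integral>\<^sup>+x\<in>{x. 0 < p i x}. ennreal ((p' i x)\<^sup>2 / p i x) \<partial>lborel) \<le> J"
    and g: "has_RN_derivative g g'" and B: "\<And>x. \<bar>g x\<bar> \<le> B" "\<And>x. \<bar>g' x\<bar> \<le> B'"
  shows "\<bar>expectation (\<lambda>w. g' (\<Sum>i\<in>I. X i w))\<bar> \<le> B * sqrt (J / sum s I)"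
proof -
  define V where "V = sum s I"
  define a where "a i = s i / V" for i
  define Z where "Z i w = a i * score (p i) (p' i) (X i w)" for i w
  let ?T = "\<lambda>w. \<Sum>i\<in>I. X i w"
  have V: "0 < V"
    unfolding V_def using I s by (intro sum_pos) auto
  have suma: "sum a I = 1"
    using V by (simp add: a_def V_def flip: sum_divide_distrib)
  have rvX[measurable]: "i \<in> I \<Longrightarrow> random_variable borel (X i)" for i
    using ind by (auto simp: indep_vars_def)
  have [measurable]: "g \<in> borel_measurable borel" "g' \<in> borel_measurable borel"
    using g by (auto intro: has_RN_derivative_measurable has_RN_derivative_measurable_derivative)
  have score_meas[measurable]: "i \<in> I \<Longrightarrow> score (p i) (p' i) \<in> borel_measurable borel" for i
    by (rule score_measurable[OF p])
  have rvZ[measurable]: "i \<in> I \<Longrightarrow> random_variable borel (Z i)" for i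
    unfolding Z_def[abs_def] by measurable
  have indZ: "indep_vars (\<lambda>_. borel) Z I"
    unfolding Z_def by (rule indep_vars_compose2[OF ind]) measurable
  note sq = score_square_integrable[OF nonneg d p fin]
  have Zsq: "integrable M (\<lambda>w. (Z i w)\<^sup>2)" if "i \<in> I" for i
    using sq(1)[OF that that that that] by (simp add: Z_def power_mult_distrib)
  have Z0: "expectation (Z i) = 0" if "i \<in> I" for i
    using expectation_score_eq_0[OF nonneg d p fin, OF that that that that] by (simp add: Z_def[abs_def])
  have sumZ: "integrable M (\<lambda>w. (\<Sum>i\<in>I. Z i w)\<^sup>2)"
    "expectation (\<lambda>w. (\<Sum>i\<in>I. Z i w)\<^sup>2) = (\<Sum>i\<in>I. expectation (\<lambda>w. (Z i w)\<^sup>2))"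
    using expectation_sum_sq_indep[OF I(1) indZ Zsq Z0] by auto
  have EZ: "expectation (\<lambda>w. (Z i w)\<^sup>2) \<le> s i * J / V\<^sup>2" if "i \<in> I" for i
  proof -
    have "expectation (\<lambda>w. (Z i w)\<^sup>2)
        = (a i)\<^sup>2 * expectation (\<lambda>w. (score (p i) (p' i) (X i w))\<^sup>2)"
      by (simp add: Z_def power_mult_distrib)
    also have "\<dots> = s i / V\<^sup>2
        * (s i * enn2real (\<integral>\<^sup>+x\<in>{x. 0 < p i x}. ennreal ((p' i x)\<^sup>2 / p i x) \<partial>lborel))"
      unfolding sq(2)[OF that that that that] by (simp add: a_def power_divide power2_eq_square)
    also have "\<dots> \<le> s i / V\<^sup>2 * J"
      using s[OF that] by (intro mult_left_mono J[OF that]) auto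
    finally show ?thesis by simp
  qed
  have "expectation (\<lambda>w. (\<Sum>i\<in>I. Z i w)\<^sup>2) \<le> (\<Sum>i\<in>I. s i * J / V\<^sup>2)"
    unfolding sumZ(2) by (intro sum_mono EZ)
  also have "\<dots> = J / V"
    using V by (simp add: V_def power2_eq_square flip: sum_distrib_right sum_divide_distrib)
  finally have EsumZ: "expectation (\<lambda>w. (\<Sum>i\<in>I. Z i w)\<^sup>2) \<le> J / V" .
  have each: "expectation (\<lambda>w. g' (?T w)) = - expectation (\<lambda>w. score (p i) (p' i) (X i w) * g (?T w))"
    "integrable M (\<lambda>w. score (p i) (p' i) (X i w) * g (?T w))" if "i \<in> I" for i
  proof -
    have ind': "indep_var borel (X i) borel (\<lambda>w. \<Sum>j\<in>I - {i}. X j w)"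
      using I that ind by (intro indep_vars_sum) (auto simp: insert_absorb)
    have T: "X i w + (\<Sum>j\<in>I - {i}. X j w) = ?T w" for w
      using I that by (simp add: sum.remove)
    show "expectation (\<lambda>w. g' (?T w)) = - expectation (\<lambda>w. score (p i) (p' i) (X i w) * g (?T w))"
      "integrable M (\<lambda>w. score (p i) (p' i) (X i w) * g (?T w))"
      using score_identity_indep[OF nonneg d p fin g B ind', OF that that that that] by (simp_all add: T)
  qed
  have "expectation (\<lambda>w. g' (?T w)) = (\<Sum>i\<in>I. a i * expectation (\<lambda>w. g' (?T w)))"
    using suma by (simp flip: sum_distrib_right)
  also have "\<dots> = (\<Sum>i\<in>I. - expectation (\<lambda>w. Z i w * g (?T w)))"
  proof (rule sum.cong[OF refl])
    fix i assume i: "i \<in> I"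
    have "a i * expectation (\<lambda>w. g' (?T w))
        = - (a i * expectation (\<lambda>w. score (p i) (p' i) (X i w) * g (?T w)))"
      using each(1)[OF i] by simp
    then show "a i * expectation (\<lambda>w. g' (?T w)) = - expectation (\<lambda>w. Z i w * g (?T w))"
      by (simp add: Z_def mult.assoc)
  qed
  also have "\<dots> = - expectation (\<lambda>w. \<Sum>i\<in>I. Z i w * g (?T w))"
    using each(2) by (subst Bochner_Integration.integral_sum) (auto simp: Z_def mult.assoc sum_negf)
  finally have "\<bar>expectation (\<lambda>w. g' (?T w))\<bar> = \<bar>expectation (\<lambda>w. (\<Sum>i\<in>I. Z i w) * g (?T w))\<bar>"
    by (simp add: sum_distrib_right)
  also have "\<dots> \<le> expectation (\<lambda>w. \<bar>(\<Sum>i\<in>I. Z i w) * g (?T w)\<bar>)"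
    by (rule integral_abs_bound)
  also have "\<dots> \<le> expectation (\<lambda>w. B * \<bar>\<Sum>i\<in>I. Z i w\<bar>)"
  proof (rule integral_mono)
    show "integrable M (\<lambda>w. \<bar>(\<Sum>i\<in>I. Z i w) * g (?T w)\<bar>)"
      using each(2)
      by (auto simp: sum_distrib_right Z_def mult.assoc intro!: integrable_abs Bochner_Integration.integrable_sum)
    show "integrable M (\<lambda>w. B * \<bar>\<Sum>i\<in>I. Z i w\<bar>)"
      using square_integrable_imp_integrable[OF _ sumZ(1)] by simp
    show "\<bar>(\<Sum>i\<in>I. Z i w) * g (?T w)\<bar> \<le> B * \<bar>\<Sum>i\<in>I. Z i w\<bar>" for w
      using B(1)[of "?T w"] by (simp add: abs_mult mult.commute[of B] mult_left_mono)
  qed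
  also have "\<dots> \<le> B * sqrt (expectation (\<lambda>w. (\<Sum>i\<in>I. Z i w)\<^sup>2))"
    using order_trans[OF abs_ge_zero B(1)[of 0]] expectation_abs_le_sqrt[OF _ sumZ(1)]
    by (simp add: mult_left_mono)
  also have "\<dots> \<le> B * sqrt (J / V)"
    using order_trans[OF abs_ge_zero B(1)[of 0]] EsumZ by (intro mult_left_mono) auto
  finally show ?thesis by (simp add: V_def)
qed

section \<open>Stein's equation\<close>

lemma has_bochner_integral_half_gaussian:
  "has_bochner_integral lborel (\<lambda>x. indicator {0..} x * exp (- x\<^sup>2 / 2)) (sqrt (pi / 2))"
proof -
  let ?F = "\<lambda>x::real. indicator {0..} x * exp (- x\<^sup>2 / 2)"
  have scale: "?F (0 + sqrt 2 * x) = indicator {0..} x *\<^sub>R exp (- x\<^sup>2)" for x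
    by (simp add: indicator_def power_mult_distrib zero_le_mult_iff)
  have "integrable lborel (\<lambda>x. ?F (0 + sqrt 2 * x))"
    unfolding scale using gaussian_moment_0 by (rule integrable.intros)
  then have "integrable lborel ?F"
    by (subst (asm) lborel_integrable_real_affine_iff) simp_all
  moreover have "(\<integral>x. ?F x \<partial>lborel) = sqrt 2 * (sqrt pi / 2)"
    using gaussian_moment_0
    by (subst lborel_integral_real_affine[of "sqrt 2" _ 0])
       (simp_all only: scale has_bochner_integral_integral_eq, simp_all)
  moreover have "sqrt 2 * (sqrt pi / 2) = sqrt (pi / 2)"
    by (simp add: real_sqrt_divide field_simps)
  ultimately show ?thesis
    by (simp add: has_bochner_integral_iff)
qed

lemma integrable_exp_neg_sq: "integrable lborel (\<lambda>x::real. exp (- x\<^sup>2 / 2))"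
proof -
  have "integrable lborel (\<lambda>x. sqrt (2 * pi) * std_normal_density x)"
    by (intro integrable_mult_right integrable_normal_density) simp
  then show ?thesis
    by (simp add: std_normal_density_def)
qed

definition gauss_tail :: "real \<Rightarrow> real" where
  "gauss_tail y = (\<integral>x. indicator {y..} x * exp (- x\<^sup>2 / 2) \<partial>lborel)"

lemma integrable_indicator_gauss:
  assumes "A \<in> sets borel"
  shows "integrable lborel (\<lambda>x. indicator A x * exp (- x\<^sup>2 / 2) :: real)"
  using integrable_mult_indicator[OF _ integrable_exp_neg_sq, of A] assms by simp

text \<open>
  The two bounds on Mills' ratio that follow are those behind the bounds on \<open>f\<close> and on \<open>x * f x\<close>.  For
  the first, shift the tail to \<open>[0, \<infinity>)\<close> and drop the mixed term of \<open>(y + x)\<^sup>2\<close>.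
\<close>

lemma gauss_tail_le_sqrt:
  assumes "0 \<le> y"
  shows "exp (y\<^sup>2 / 2) * gauss_tail y \<le> sqrt (pi / 2)"
proof -
  have shift: "indicator {y..} (y + 1 * x) = (indicator {0..} x :: real)" for x
    by (simp add: indicator_def)
  have "gauss_tail y = (\<integral>x. indicator {0..} x * exp (- (y + x)\<^sup>2 / 2) \<partial>lborel)"
    unfolding gauss_tail_def
    by (subst lborel_integral_real_affine[of 1 _ y]) (simp_all only: shift, simp_all)
  also have "\<dots> \<le> (\<integral>x. exp (- y\<^sup>2 / 2) * (indicator {0..} x * exp (- x\<^sup>2 / 2)) \<partial>lborel)"
  proof (rule integral_mono)
    show "integrable lborel (\<lambda>x. indicator {0..} x * exp (- (y + x)\<^sup>2 / 2))"
      using lborel_integrable_real_affine[OF integrable_indicator_gauss[of "{y..}"], of 1 y]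
      by (simp only: shift) simp
    show "integrable lborel (\<lambda>x. exp (- y\<^sup>2 / 2) * (indicator {0..} x * exp (- x\<^sup>2 / 2)))"
      by (intro integrable_mult_right integrable_indicator_gauss) simp
    show "indicator {0..} x * exp (- (y + x)\<^sup>2 / 2)
        \<le> exp (- y\<^sup>2 / 2) * (indicator {0..} x * exp (- x\<^sup>2 / 2))" for x
    proof (cases "0 \<le> x")
      case True
      then have "- (y + x)\<^sup>2 / 2 \<le> - y\<^sup>2 / 2 + - x\<^sup>2 / 2"
        using assms by (simp add: power2_sum)
      then have "exp (- (y + x)\<^sup>2 / 2) \<le> exp (- y\<^sup>2 / 2) * exp (- x\<^sup>2 / 2)"
        by (simp only: exp_add[symmetric] exp_le_cancel_iff)
      then show ?thesis using True by simp
    qed simp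
  qed
  also have "\<dots> = exp (- y\<^sup>2 / 2) * sqrt (pi / 2)"
    using has_bochner_integral_integral_eq[OF has_bochner_integral_half_gaussian] by simp
  finally show ?thesis
    by (simp add: exp_minus field_simps)
qed

text \<open>On \<open>[y, \<infinity>)\<close> the factor \<open>y\<close> is at most \<open>x\<close>, and \<open>x * exp (- x\<^sup>2 / 2)\<close> has an explicit primitive.\<close>

lemma gauss_tail_le_inverse:
  assumes "0 \<le> y"
  shows "y * (exp (y\<^sup>2 / 2) * gauss_tail y) \<le> 1"
proof -
  have "(\<integral>\<^sup>+x. ennreal (x * exp (- x\<^sup>2 / 2)) * indicator {y..} x \<partial>lborel)
      = ennreal (0 - (- exp (- y\<^sup>2 / 2)))"
  proof (rule nn_integral_FTC_atLeast)
    have "((\<lambda>x::real. - exp (- x\<^sup>2 / 2)) \<longlongrightarrow> - 0) at_top"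
      by real_asymp
    then show "((\<lambda>x::real. - exp (- x\<^sup>2 / 2)) \<longlongrightarrow> 0) at_top"
      by simp
  qed (use assms in \<open>auto intro!: derivative_eq_intros\<close>)
  moreover have "ennreal (y * gauss_tail y)
      \<le> (\<integral>\<^sup>+x. ennreal (x * exp (- x\<^sup>2 / 2)) * indicator {y..} x \<partial>lborel)"
  proof -
    have "ennreal (y * gauss_tail y)
        = (\<integral>\<^sup>+x. ennreal (y * (indicator {y..} x * exp (- x\<^sup>2 / 2))) \<partial>lborel)"
      unfolding gauss_tail_def using assms
      using integrable_mult_right[OF integrable_indicator_gauss[of "{y..}"], of y]
      by (subst nn_integral_eq_integral) auto
    also have "\<dots> \<le> (\<integral>\<^sup>+x. ennreal (x * exp (- x\<^sup>2 / 2)) * indicator {y..} x \<partial>lborel)"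
      by (intro nn_integral_mono) (auto simp: indicator_def intro!: ennreal_leI mult_right_mono)
    finally show ?thesis .
  qed
  ultimately have "y * gauss_tail y \<le> exp (- y\<^sup>2 / 2)"
    by simp
  then show ?thesis
    by (simp add: exp_minus field_simps)
qed

lemma gauss_tail_reflect:
  "(\<integral>x. indicator {..y} x * exp (- x\<^sup>2 / 2) \<partial>lborel) = gauss_tail (- y)"
proof -
  have "indicator {..y} (0 + - 1 * x) = (indicator {- y..} x :: real)" for x
    by (simp add: indicator_def)
  then show ?thesis
    unfolding gauss_tail_def by (subst lborel_integral_real_affine[of "- 1" _ 0]) simp_all
qed

text \<open>
  The solution is \<open>f x = exp (x\<^sup>2 / 2) * G x\<close> with \<open>G\<close> the integral over \<open>(-\<infinity>, x]\<close> of the centred test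
  function against \<open>exp (- t\<^sup>2 / 2)\<close>.  The centred function integrates to \<open>0\<close> over the line, so \<open>G x\<close> is
  up to its sign also an integral over \<open>(x, \<infinity>)\<close>; for either sign of \<open>x\<close> it is thus controlled by the
  Gaussian tail beyond \<open>\<bar>x\<bar>\<close>.
\<close>

lemma stein_equation_solution:
  assumes h[measurable]: "h \<in> borel_measurable borel" and h1: "\<And>x. \<bar>h x\<bar> \<le> (1::real)"
  obtains f f' where "has_RN_derivative f f'"
    and "\<And>x. \<bar>f x\<bar> \<le> sqrt (2 * pi)" and "\<And>x. \<bar>f' x\<bar> \<le> 4"
    and "\<And>x. f' x = x * f x + (h x - (\<integral>y. std_normal_density y * h y \<partial>lborel))"
proof -
  define c where "c = (\<integral>y. std_normal_density y * h y \<partial>lborel)"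
  define k where "k x = h x - c" for x
  define e :: "real \<Rightarrow> real" where "e x = exp (- x\<^sup>2 / 2)" for x
  have e_pos: "0 < e x" and exp_e: "exp (x\<^sup>2 / 2) * e x = 1" for x
    by (simp_all add: e_def flip: exp_add)
  have int_h: "integrable lborel (\<lambda>y. std_normal_density y * h y)"
  proof (rule Bochner_Integration.integrable_bound)
    show "integrable lborel std_normal_density"
      by (rule integrable_normal_density) simp
    show "AE y in lborel. norm (std_normal_density y * h y) \<le> norm (std_normal_density y)"
      using h1 by (intro AE_I2) (simp add: abs_mult mult_left_le)
  qed measurable
  have int1: "(\<integral>y. std_normal_density y \<partial>lborel) = 1"
    by (rule integral_normal_density) simp
  have c1: "\<bar>c\<bar> \<le> 1"
  proof -
    have "\<bar>c\<bar> \<le> (\<integral>y. \<bar>std_normal_density y * h y\<bar> \<partial>lborel)"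
      unfolding c_def by (rule integral_abs_bound)
    also have "\<dots> \<le> (\<integral>y. std_normal_density y \<partial>lborel)"
    proof (rule integral_mono)
      show "\<bar>std_normal_density y * h y\<bar> \<le> std_normal_density y" for y
        using h1[of y] by (simp add: abs_mult mult_left_le)
    qed (use int_h in \<open>auto intro: integrable_normal_density\<close>)
    finally show ?thesis using int1 by simp
  qed
  have k2: "\<bar>k x\<bar> \<le> 2" for x
    using h1[of x] c1 by (simp add: k_def)
  have [measurable]: "k \<in> borel_measurable borel" "e \<in> borel_measurable borel"
    unfolding k_def[abs_def] e_def[abs_def] by measurable
  have dens: "std_normal_density x = e x / sqrt (2 * pi)" for x
    by (simp add: std_normal_density_def e_def)
  have ke: "integrable lborel (\<lambda>x. indicator A x * (k x * e x))" if [measurable]: "A \<in> sets borel" for A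
  proof (rule Bochner_Integration.integrable_bound)
    show "integrable lborel (\<lambda>x. 2 * e x)"
      using integrable_exp_neg_sq by (simp add: e_def)
    show "AE x in lborel. norm (indicator A x * (k x * e x)) \<le> norm (2 * e x)"
      using k2 by (intro AE_I2) (auto simp: indicator_def abs_mult simp del: mult_le_cancel_right intro!: mult_right_mono)
  qed measurable
  have ke0: "(\<integral>x. k x * e x \<partial>lborel) = 0"
  proof -
    have "(\<integral>x. k x * e x \<partial>lborel)
        = (\<integral>x. sqrt (2 * pi) * (std_normal_density x * h x - c * std_normal_density x) \<partial>lborel)"
      by (intro Bochner_Integration.integral_cong) (auto simp: dens k_def algebra_simps)
    also have "\<dots> = sqrt (2 * pi) * (c - c * 1)"
      using int_h integrable_normal_density[of 1 0] by (simp add: int1 c_def)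
    finally show ?thesis by simp
  qed
  define G where "G x = (\<integral>t. indicator {..x} t * (k t * e t) \<partial>lborel)" for x
  define f where "f x = exp (x\<^sup>2 / 2) * G x" for x
  have G: "has_RN_derivative G (\<lambda>x. k x * e x)"
  proof (rule has_RN_derivativeI)
    fix a b :: real
    assume ab: "a \<le> b"
    show "integrable lborel (\<lambda>x. indicator {a..b} x * (k x * e x))"
      by (rule ke) simp
    have "G b - G a = (\<integral>t. indicator {..b} t * (k t * e t) - indicator {..a} t * (k t * e t) \<partial>lborel)"
      unfolding G_def by (subst Bochner_Integration.integral_diff[OF ke ke]) auto
    also have "\<dots> = (\<integral>t. indicator {a..b} t * (k t * e t) \<partial>lborel)"
    proof (rule integral_cong_AE)
      show "AE t in lborel. indicator {..b} t * (k t * e t) - indicator {..a} t * (k t * e t)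
          = indicator {a..b} t * (k t * e t)"
        using AE_lborel_singleton[of a] by eventually_elim (use ab in \<open>auto simp: indicator_def\<close>)
    qed measurable
    finally show "G b - G a = (\<integral>t. indicator {a..b} t * (k t * e t) \<partial>lborel)" .
  qed
  have tail: "\<bar>\<integral>t. indicator A t * (k t * e t) \<partial>lborel\<bar> \<le> 2 * (\<integral>t. indicator A t * e t \<partial>lborel)"
    if A[measurable]: "A \<in> sets borel" for A
  proof -
    have "\<bar>\<integral>t. indicator A t * (k t * e t) \<partial>lborel\<bar> \<le> (\<integral>t. \<bar>indicator A t * (k t * e t)\<bar> \<partial>lborel)"
      by (rule integral_abs_bound)
    also have "\<dots> \<le> (\<integral>t. 2 * (indicator A t * e t) \<partial>lborel)"
    proof (rule integral_mono)
      show "\<bar>indicator A t * (k t * e t)\<bar> \<le> 2 * (indicator A t * e t)" for t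
        using k2[of t] e_pos[of t] by (simp add: indicator_def abs_mult mult_right_mono)
    qed (use ke[OF A] integrable_indicator_gauss[OF A] in \<open>auto simp: e_def\<close>)
    finally show ?thesis by simp
  qed
  have G_le: "\<bar>G x\<bar> \<le> 2 * gauss_tail \<bar>x\<bar>" for x
  proof (cases "x \<le> 0")
    case True
    then show ?thesis
      using tail[of "{..x}"] gauss_tail_reflect[of x] by (simp add: G_def e_def)
  next
    case False
    have "G x + (\<integral>t. indicator {x<..} t * (k t * e t) \<partial>lborel)
        = (\<integral>t. indicator {..x} t * (k t * e t) + indicator {x<..} t * (k t * e t) \<partial>lborel)"
      unfolding G_def by (subst Bochner_Integration.integral_add[OF ke ke]) auto
    also have "\<dots> = (\<integral>t. k t * e t \<partial>lborel)"
      by (intro Bochner_Integration.integral_cong) (auto simp: indicator_def)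
    finally have "\<bar>G x\<bar> = \<bar>\<integral>t. indicator {x<..} t * (k t * e t) \<partial>lborel\<bar>"
      using ke0 by linarith
    also have "\<dots> \<le> 2 * (\<integral>t. indicator {x<..} t * e t \<partial>lborel)"
      by (rule tail) simp
    also have "\<dots> \<le> 2 * gauss_tail x"
      unfolding gauss_tail_def e_def
      by (intro mult_left_mono integral_mono integrable_indicator_gauss) (auto simp: indicator_def)
    finally show ?thesis using False by simp
  qed
  have f_le: "\<bar>f x\<bar> \<le> 2 * (exp (\<bar>x\<bar>\<^sup>2 / 2) * gauss_tail \<bar>x\<bar>)" for x
    using G_le[of x] by (simp add: f_def abs_mult)
  have "has_RN_derivative (\<lambda>x. exp (x\<^sup>2 / 2)) (\<lambda>x. x * exp (x\<^sup>2 / 2))"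
    by (intro has_RN_derivative_C1) (auto intro!: derivative_eq_intros continuous_intros)
  from has_RN_derivative_mult[OF this G]
  have "has_RN_derivative f (\<lambda>x. x * exp (x\<^sup>2 / 2) * G x + exp (x\<^sup>2 / 2) * (k x * e x))"
    by (simp add: f_def[abs_def])
  moreover have "x * exp (x\<^sup>2 / 2) * G x + exp (x\<^sup>2 / 2) * (k x * e x) = x * f x + k x" for x
    using exp_e[of x] by (simp add: f_def mult.left_commute[of _ "k x"])
  ultimately have f: "has_RN_derivative f (\<lambda>x. x * f x + k x)"
    by simp
  show thesis
  proof (rule that[OF f])
    fix x
    have "\<bar>f x\<bar> \<le> 2 * sqrt (pi / 2)"
      using f_le[of x] gauss_tail_le_sqrt[of "\<bar>x\<bar>"] by linarith
    also have "\<dots> = sqrt (2 * pi)"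
      by (simp add: real_sqrt_divide real_sqrt_mult field_simps)
    finally show "\<bar>f x\<bar> \<le> sqrt (2 * pi)" .
    have "\<bar>x\<bar> * \<bar>f x\<bar> \<le> \<bar>x\<bar> * (2 * (exp (\<bar>x\<bar>\<^sup>2 / 2) * gauss_tail \<bar>x\<bar>))"
      by (intro mult_left_mono f_le) simp
    also have "\<dots> \<le> 2"
      using gauss_tail_le_inverse[of "\<bar>x\<bar>"] by (simp add: mult.left_commute)
    finally show "\<bar>x * f x + k x\<bar> \<le> 4"
      using k2[of x] abs_triangle_ineq[of "x * f x" "k x"] by (simp add: abs_mult)
    show "x * f x + k x = x * f x + (h x - (\<integral>y. std_normal_density y * h y \<partial>lborel))"
      by (simp add: k_def c_def)
  qed
qed

section \<open>Isolating one summand\<close>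

lemma (in prob_space) has_RN_derivative_expectation_shift:
  fixes Y :: "'a \<Rightarrow> real"
  assumes [measurable]: "random_variable borel Y" and f: "has_RN_derivative f f'"
    and B: "\<And>x. \<bar>f x\<bar> \<le> A" "\<And>x. \<bar>f' x\<bar> \<le> B"
  shows "has_RN_derivative (\<lambda>z. expectation (\<lambda>w. f (Y w + z))) (\<lambda>z. expectation (\<lambda>w. f' (Y w + z)))"
proof (rule has_RN_derivativeI)
  fix a b :: real
  assume ab: "a \<le> b"
  interpret P: pair_sigma_finite M "lborel :: real measure" ..
  have [measurable]: "f \<in> borel_measurable borel" "f' \<in> borel_measurable borel"
    using f by (auto intro: has_RN_derivative_measurable has_RN_derivative_measurable_derivative)
  have f_shift: "has_RN_derivative (\<lambda>t. f (y + t)) (\<lambda>t. f' (y + t))" for y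
    using has_RN_derivative_affine[OF f zero_less_one, of y] by simp
  have const: "integrable lborel (\<lambda>t. indicator {a..b} t * c)" for c :: real
    by (intro integrable_mult_left integrable_real_indicator) (simp_all add: emeasure_lborel_Icc_eq)
  have int: "integrable (M \<Otimes>\<^sub>M lborel) (\<lambda>(w, t). indicator {a..b} t * f' (Y w + t))"
  proof (rule P.Fubini_integrable)
    show "(\<lambda>(w, t). indicator {a..b} t * f' (Y w + t)) \<in> borel_measurable (M \<Otimes>\<^sub>M lborel)"
      by measurable
    show "AE w in M. integrable lborel
        (\<lambda>t. case (w, t) of (w, t) \<Rightarrow> indicator {a..b} t * f' (Y w + t))"
      using has_RN_derivative_integrable[OF f_shift] by simp
    have "norm (\<integral>t. norm (indicator {a..b} t * f' (Y w + t)) \<partial>lborel)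
        \<le> (\<integral>t. indicator {a..b} t * B \<partial>lborel)" for w
    proof -
      have "(\<integral>t. norm (indicator {a..b} t * f' (Y w + t)) \<partial>lborel)
          \<le> (\<integral>t. indicator {a..b} t * B \<partial>lborel)"
        by (rule integral_mono[OF integrable_norm[OF has_RN_derivative_integrable[OF f_shift]] const])
           (use B(2) in \<open>simp add: indicator_def\<close>)
      then show ?thesis by simp
    qed
    then show "integrable M (\<lambda>w. \<integral>t. norm (case (w, t) of (w, t) \<Rightarrow> indicator {a..b} t * f' (Y w + t)) \<partial>lborel)"
      by (intro integrable_const_bound AE_I2) auto
  qed
  have inner: "expectation (\<lambda>w. indicator {a..b} t * f' (Y w + t))
      = indicator {a..b} t * expectation (\<lambda>w. f' (Y w + t))" for t
    by simp
  show "integrable lborel (\<lambda>t. indicator {a..b} t * expectation (\<lambda>w. f' (Y w + t)))"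
    using P.integrable_snd[OF int] by (simp only: inner)
  have int_f: "integrable M (\<lambda>w. f (Y w + z))" for z
    by (rule integrable_const_bound[of _ A]) (auto simp: B)
  have "expectation (\<lambda>w. f (Y w + b)) - expectation (\<lambda>w. f (Y w + a))
      = expectation (\<lambda>w. f (Y w + b) - f (Y w + a))"
    by (rule Bochner_Integration.integral_diff[symmetric, OF int_f int_f])
  also have "\<dots> = expectation (\<lambda>w. \<integral>t. indicator {a..b} t * f' (Y w + t) \<partial>lborel)"
    by (simp only: has_RN_derivative_increment[OF f_shift ab])
  also have "\<dots> = (\<integral>t. expectation (\<lambda>w. indicator {a..b} t * f' (Y w + t)) \<partial>lborel)"
    by (rule P.Fubini_integral[symmetric, OF int])
  finally show "expectation (\<lambda>w. f (Y w + b)) - expectation (\<lambda>w. f (Y w + a))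
      = (\<integral>t. indicator {a..b} t * expectation (\<lambda>w. f' (Y w + t)) \<partial>lborel)"
    by (simp only: inner)
qed

lemma (in prob_space) integrable_sq_mult_min:
  fixes Z :: "'a \<Rightarrow> real"
  assumes [measurable]: "random_variable borel Z" and sq: "integrable M (\<lambda>w. (Z w)\<^sup>2)"
  shows "integrable M (\<lambda>w. (Z w)\<^sup>2 * min \<bar>Z w\<bar> 1)"
proof (rule Bochner_Integration.integrable_bound[OF sq])
  show "AE w in M. norm ((Z w)\<^sup>2 * min \<bar>Z w\<bar> 1) \<le> norm ((Z w)\<^sup>2)"
    by (intro AE_I2) (simp add: abs_mult mult_left_le)
qed measurable

text \<open>
  Two increasing functions of \<open>\<bar>Z\<bar>\<close> are positively correlated.  With \<open>m = E min \<bar>Z\<bar> 1 \<le> 1\<close>, neither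
  \<open>Z\<^sup>2 - m\<^sup>2\<close> nor \<open>min \<bar>Z\<bar> 1 - m\<close> is negative for \<open>\<bar>Z\<bar> \<ge> m\<close> or positive for \<open>\<bar>Z\<bar> < m\<close>, so their
  product is nonnegative; its expectation is the difference of the two sides.
\<close>

lemma (in prob_space) expectation_sq_mult_expectation_min_le:
  fixes Z :: "'a \<Rightarrow> real"
  assumes [measurable]: "random_variable borel Z" and sq: "integrable M (\<lambda>w. (Z w)\<^sup>2)"
  shows "expectation (\<lambda>w. (Z w)\<^sup>2) * expectation (\<lambda>w. min \<bar>Z w\<bar> 1)
    \<le> expectation (\<lambda>w. (Z w)\<^sup>2 * min \<bar>Z w\<bar> 1)"
proof -
  define m where "m = expectation (\<lambda>w. min \<bar>Z w\<bar> 1)"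
  have int: "integrable M (\<lambda>w. min \<bar>Z w\<bar> 1)"
    by (rule integrable_const_bound[of _ 1]) auto
  have m: "0 \<le> m" "m \<le> 1"
    unfolding m_def using integral_mono[OF int, of "\<lambda>_. 1"] by (auto intro!: integral_nonneg_AE simp: prob_space)
  have pos: "0 \<le> ((Z w)\<^sup>2 - m\<^sup>2) * (min \<bar>Z w\<bar> 1 - m)" for w
  proof (cases "m \<le> \<bar>Z w\<bar>")
    case True
    then have "m\<^sup>2 \<le> (Z w)\<^sup>2" using m(1) by (simp add: abs_le_square_iff[symmetric])
    then show ?thesis using True m by (intro mult_nonneg_nonneg) auto
  next
    case False
    then have "(Z w)\<^sup>2 \<le> m\<^sup>2" using m(1) by (simp add: abs_le_square_iff[symmetric])
    then show ?thesis using False m by (intro mult_nonpos_nonpos) auto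
  qed
  have "0 \<le> expectation (\<lambda>w. ((Z w)\<^sup>2 - m\<^sup>2) * (min \<bar>Z w\<bar> 1 - m))"
    using pos by (intro integral_nonneg_AE AE_I2)
  also have "\<dots> = expectation (\<lambda>w. (Z w)\<^sup>2 * min \<bar>Z w\<bar> 1 - m * (Z w)\<^sup>2 - (m\<^sup>2 * min \<bar>Z w\<bar> 1 - m\<^sup>2 * m))"
    by (simp add: algebra_simps)
  also have "\<dots> = expectation (\<lambda>w. (Z w)\<^sup>2 * min \<bar>Z w\<bar> 1) - m * expectation (\<lambda>w. (Z w)\<^sup>2)"
    using integrable_sq_mult_min[OF _ sq] sq int by (simp add: prob_space m_def[symmetric])
  finally show ?thesis
    unfolding m_def by (simp add: mult.commute)
qed

text \<open>
  Let \<open>F z = E f'(Y + z)\<close> and let \<open>G z = E f(Y + z)\<close> be its primitive.  Since \<open>Z\<close> is centred,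
  \<open>E (Z * f(Y + Z)) = E (Z * (G Z - G 0))\<close>.  Replacing \<open>G Z - G 0\<close> by \<open>F 0 * Z\<close> costs
  \<open>C * E (Z\<^sup>2 * min \<bar>Z\<bar> 1)\<close>, and replacing \<open>E f'(Y + Z) = E F(Z)\<close> by \<open>F 0\<close> costs
  \<open>C * E Z\<^sup>2 * E min \<bar>Z\<bar> 1\<close>, which is at most the same amount because \<open>Z\<^sup>2\<close> and \<open>min \<bar>Z\<bar> 1\<close> are positively
  correlated.
\<close>

lemma (in prob_space) stein_one_summand:
  fixes Y Z :: "'a \<Rightarrow> real"
  assumes ind: "indep_var borel Y borel Z"
    and sq: "integrable M (\<lambda>w. (Z w)\<^sup>2)" and mean: "expectation Z = 0"
    and f: "has_RN_derivative f f'" and B: "\<And>x. \<bar>f x\<bar> \<le> A" "\<And>x. \<bar>f' x\<bar> \<le> B"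
    and C: "\<And>x t. \<bar>expectation (\<lambda>w. f' (Y w + x)) - expectation (\<lambda>w. f' (Y w + t))\<bar>
      \<le> C * min \<bar>x - t\<bar> 1"
  shows "\<bar>expectation (\<lambda>w. (Z w)\<^sup>2) * expectation (\<lambda>w. f' (Y w + Z w))
      - expectation (\<lambda>w. Z w * f (Y w + Z w))\<bar>
    \<le> 2 * C * expectation (\<lambda>w. (Z w)\<^sup>2 * min \<bar>Z w\<bar> 1)"
    and "integrable M (\<lambda>w. Z w * f (Y w + Z w))"
proof -
  have [measurable]: "random_variable borel Y" "random_variable borel Z"
    using ind by (auto simp: indep_var_distribution_eq)
  have [measurable]: "f \<in> borel_measurable borel" "f' \<in> borel_measurable borel"
    using f by (auto intro: has_RN_derivative_measurable has_RN_derivative_measurable_derivative)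
  define F where "F z = expectation (\<lambda>w. f' (Y w + z))" for z
  define G where "G z = expectation (\<lambda>w. f (Y w + z))" for z
  (* the remainder of the first order expansion of G at 0 *)
  define q where "q z = G z - G 0 - F 0 * z" for z
  have GF: "has_RN_derivative G F"
    unfolding F_def[abs_def] G_def[abs_def]
    by (rule has_RN_derivative_expectation_shift[OF _ f B]) measurable
  have [measurable]: "F \<in> borel_measurable borel" "G \<in> borel_measurable borel"
    using GF by (auto intro: has_RN_derivative_measurable has_RN_derivative_measurable_derivative)
  have [measurable]: "q \<in> borel_measurable borel"
    unfolding q_def[abs_def] by measurable
  have C0: "0 \<le> C"
    using C[of 1 0] by simp
  have q_le: "\<bar>q z\<bar> \<le> C * min \<bar>z\<bar> 1 * \<bar>z\<bar>" for z
  proof -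
    have id: "has_RN_derivative (\<lambda>z. F 0 * z) (\<lambda>_. F 0)"
      by (rule has_RN_derivative_C1) (auto intro!: derivative_eq_intros)
    have "\<bar>(G z - F 0 * z) - (G 0 - F 0 * 0)\<bar> \<le> C * min \<bar>z\<bar> 1 * \<bar>z - 0\<bar>"
    proof (rule has_RN_derivative_increment_le[OF has_RN_derivative_diff[OF GF id]])
      fix t assume "t \<in> closed_segment 0 z"
      then have "min \<bar>t - 0\<bar> 1 \<le> min \<bar>z\<bar> 1"
        by (auto simp: closed_segment_eq_real_ivl split: if_splits)
      then have "C * min \<bar>t - 0\<bar> 1 \<le> C * min \<bar>z\<bar> 1"
        using C0 by (rule mult_left_mono)
      then show "\<bar>F t - F 0\<bar> \<le> C * min \<bar>z\<bar> 1"
        using C[of t 0] unfolding F_def by linarith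
    qed
    then show ?thesis by (simp add: q_def algebra_simps)
  qed
  have intZ: "integrable M Z"
    using square_integrable_imp_integrable[OF _ sq] by simp
  have m1: "(\<lambda>(y, z). f' (y + z)) \<in> borel_measurable borel"
    and m2: "(\<lambda>(y, z). z * f (y + z)) \<in> borel_measurable borel"
    unfolding borel_prod[symmetric] by measurable
  have int1: "integrable M (\<lambda>w. f' (Y w + Z w))"
    by (rule integrable_const_bound[of _ B]) (auto simp: B)
  show int2: "integrable M (\<lambda>w. Z w * f (Y w + Z w))"
  proof (rule Bochner_Integration.integrable_bound)
    show "integrable M (\<lambda>w. A * Z w)" using intZ by simp
    show "AE w in M. norm (Z w * f (Y w + Z w)) \<le> norm (A * Z w)"
    proof (rule AE_I2)
      fix w
      have "\<bar>f (Y w + Z w)\<bar> \<le> \<bar>A\<bar>" using B(1)[of "Y w + Z w"] by linarith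
      then show "norm (Z w * f (Y w + Z w)) \<le> norm (A * Z w)"
        by (simp add: abs_mult mult.commute[of "\<bar>A\<bar>"] mult_left_mono)
    qed
  qed measurable
  have EF: "expectation (\<lambda>w. f' (Y w + Z w)) = expectation (\<lambda>w. F (Z w))" "integrable M (\<lambda>w. F (Z w))"
    using expectation_indep_pair[OF ind m1] int1 by (simp_all add: F_def)
  have EG: "expectation (\<lambda>w. Z w * f (Y w + Z w)) = expectation (\<lambda>w. Z w * G (Z w))"
    "integrable M (\<lambda>w. Z w * G (Z w))"
    using expectation_indep_pair[OF ind m2] int2 by (simp_all add: G_def)
  have int_min: "integrable M (\<lambda>w. min \<bar>Z w\<bar> 1)"
    by (rule integrable_const_bound[of _ 1]) auto
  have int_sqmin: "integrable M (\<lambda>w. (Z w)\<^sup>2 * min \<bar>Z w\<bar> 1)"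
    by (rule integrable_sq_mult_min[OF _ sq]) simp
  have Zq: "Z w * G (Z w) = Z w * q (Z w) + (G 0 * Z w + F 0 * (Z w)\<^sup>2)" for w
    by (simp add: q_def algebra_simps power2_eq_square)
  have int_Zq: "integrable M (\<lambda>w. Z w * q (Z w))"
  proof -
    have "integrable M (\<lambda>w. Z w * G (Z w) - (G 0 * Z w + F 0 * (Z w)\<^sup>2))"
      by (intro Bochner_Integration.integrable_diff Bochner_Integration.integrable_add
          integrable_mult_right EG(2) intZ sq)
    then show ?thesis by (simp add: Zq)
  qed
  have EZG: "expectation (\<lambda>w. Z w * G (Z w)) = expectation (\<lambda>w. Z w * q (Z w)) + F 0 * expectation (\<lambda>w. (Z w)\<^sup>2)"
    unfolding Zq using int_Zq intZ sq mean by simp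
  have Zq_le: "\<bar>expectation (\<lambda>w. Z w * q (Z w))\<bar> \<le> C * expectation (\<lambda>w. (Z w)\<^sup>2 * min \<bar>Z w\<bar> 1)"
  proof -
    have "\<bar>expectation (\<lambda>w. Z w * q (Z w))\<bar> \<le> expectation (\<lambda>w. \<bar>Z w * q (Z w)\<bar>)"
      by (rule integral_abs_bound)
    also have "\<dots> \<le> expectation (\<lambda>w. C * ((Z w)\<^sup>2 * min \<bar>Z w\<bar> 1))"
    proof (rule integral_mono)
      show "\<bar>Z w * q (Z w)\<bar> \<le> C * ((Z w)\<^sup>2 * min \<bar>Z w\<bar> 1)" for w
      proof -
        have "\<bar>Z w * q (Z w)\<bar> \<le> \<bar>Z w\<bar> * (C * min \<bar>Z w\<bar> 1 * \<bar>Z w\<bar>)"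
          unfolding abs_mult by (intro mult_left_mono q_le) simp
        also have "\<dots> = C * ((\<bar>Z w\<bar> * \<bar>Z w\<bar>) * min \<bar>Z w\<bar> 1)"
          by (simp only: mult_ac)
        finally show ?thesis by (simp add: power2_eq_square)
      qed
    qed (use int_Zq int_sqmin in auto)
    finally show ?thesis by simp
  qed
  have F_le: "\<bar>expectation (\<lambda>w. F (Z w)) - F 0\<bar> \<le> C * expectation (\<lambda>w. min \<bar>Z w\<bar> 1)"
  proof -
    have "expectation (\<lambda>w. F (Z w)) - F 0 = expectation (\<lambda>w. F (Z w) - F 0)"
      using EF(2) by (simp add: prob_space)
    also have "\<bar>\<dots>\<bar> \<le> expectation (\<lambda>w. \<bar>F (Z w) - F 0\<bar>)"
      by (rule integral_abs_bound)
    also have "\<dots> \<le> expectation (\<lambda>w. C * min \<bar>Z w\<bar> 1)"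
      by (rule integral_mono) (use EF(2) int_min C[of _ 0] in \<open>auto simp: F_def\<close>)
    finally show ?thesis by simp
  qed
  let ?v = "expectation (\<lambda>w. (Z w)\<^sup>2)" and ?e = "expectation (\<lambda>w. (Z w)\<^sup>2 * min \<bar>Z w\<bar> 1)"
  have v0: "0 \<le> ?v" by (intro integral_nonneg_AE) auto
  have "\<bar>?v * (expectation (\<lambda>w. F (Z w)) - F 0)\<bar> \<le> ?v * (C * expectation (\<lambda>w. min \<bar>Z w\<bar> 1))"
    using v0 F_le by (simp add: abs_mult mult_left_mono)
  also have "\<dots> = C * (?v * expectation (\<lambda>w. min \<bar>Z w\<bar> 1))"
    by simp
  also have "\<dots> \<le> C * ?e"
    by (intro mult_left_mono expectation_sq_mult_expectation_min_le sq C0) simp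
  finally have vF: "\<bar>?v * (expectation (\<lambda>w. F (Z w)) - F 0)\<bar> \<le> C * ?e" .
  have "?v * expectation (\<lambda>w. f' (Y w + Z w)) - expectation (\<lambda>w. Z w * f (Y w + Z w))
      = ?v * (expectation (\<lambda>w. F (Z w)) - F 0) - expectation (\<lambda>w. Z w * q (Z w))"
    unfolding EF(1) EG(1) EZG by (simp add: algebra_simps)
  then show "\<bar>?v * expectation (\<lambda>w. f' (Y w + Z w)) - expectation (\<lambda>w. Z w * f (Y w + Z w))\<bar>
      \<le> 2 * C * ?e"
    using vF Zq_le by linarith
qed

lemma (in prob_space) indep_var_swap:
  assumes "indep_var S X T Y"
  shows "indep_var T Y S X"
proof -
  have "indep_set B A" if "indep_set A B" for A B
    unfolding indep_sets2_eq
  proof (intro conjI ballI)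
    fix b a assume "b \<in> B" "a \<in> A"
    then have "prob (a \<inter> b) = prob a * prob b"
      using that by (simp add: indep_sets2_eq)
    then show "prob (b \<inter> a) = prob b * prob a"
      by (simp only: Int_commute[of b a] mult.commute[of "prob b"])
  qed (use that in \<open>simp_all add: indep_sets2_eq\<close>)
  then show ?thesis
    using assms by (simp add: indep_var_eq)
qed

lemma (in prob_space) stein_sum:
  fixes \<xi> :: "'i \<Rightarrow> 'a \<Rightarrow> real"
  assumes I: "finite I" and ind: "indep_vars (\<lambda>_. borel) \<xi> I"
    and sq: "\<And>k. k \<in> I \<Longrightarrow> integrable M (\<lambda>w. (\<xi> k w)\<^sup>2)"
    and mean: "\<And>k. k \<in> I \<Longrightarrow> expectation (\<xi> k) = 0"
    and var: "(\<Sum>k\<in>I. expectation (\<lambda>w. (\<xi> k w)\<^sup>2)) = 1"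
    and f: "has_RN_derivative f f'" and B: "\<And>x. \<bar>f x\<bar> \<le> A" "\<And>x. \<bar>f' x\<bar> \<le> B"
    and C: "\<And>k x t. k \<in> I \<Longrightarrow>
      \<bar>expectation (\<lambda>w. f' ((\<Sum>i\<in>I - {k}. \<xi> i w) + x))
        - expectation (\<lambda>w. f' ((\<Sum>i\<in>I - {k}. \<xi> i w) + t))\<bar> \<le> C * min \<bar>x - t\<bar> 1"
  shows "\<bar>expectation (\<lambda>w. f' (\<Sum>k\<in>I. \<xi> k w))
      - expectation (\<lambda>w. (\<Sum>k\<in>I. \<xi> k w) * f (\<Sum>k\<in>I. \<xi> k w))\<bar>
    \<le> 2 * C * (\<Sum>k\<in>I. expectation (\<lambda>w. (\<xi> k w)\<^sup>2 * min \<bar>\<xi> k w\<bar> 1))"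
    and "integrable M (\<lambda>w. (\<Sum>k\<in>I. \<xi> k w) * f (\<Sum>k\<in>I. \<xi> k w))"
proof -
  let ?W = "\<lambda>w. \<Sum>k\<in>I. \<xi> k w"
  let ?e = "\<lambda>k. expectation (\<lambda>w. (\<xi> k w)\<^sup>2 * min \<bar>\<xi> k w\<bar> 1)"
  have one: "\<bar>expectation (\<lambda>w. (\<xi> k w)\<^sup>2) * expectation (\<lambda>w. f' (?W w))
        - expectation (\<lambda>w. \<xi> k w * f (?W w))\<bar> \<le> 2 * C * ?e k"
    "integrable M (\<lambda>w. \<xi> k w * f (?W w))" if k: "k \<in> I" for k
  proof -
    have W: "(\<Sum>i\<in>I - {k}. \<xi> i w) + \<xi> k w = ?W w" for w
      using I k by (simp add: sum.remove)
    have "indep_var borel (\<xi> k) borel (\<lambda>w. \<Sum>i\<in>I - {k}. \<xi> i w)"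
      using I k ind by (intro indep_vars_sum) (auto simp: insert_absorb)
    note step = stein_one_summand[OF indep_var_swap[OF this] sq[OF k] mean[OF k] f B C[OF k]]
    show "\<bar>expectation (\<lambda>w. (\<xi> k w)\<^sup>2) * expectation (\<lambda>w. f' (?W w))
        - expectation (\<lambda>w. \<xi> k w * f (?W w))\<bar> \<le> 2 * C * ?e k"
      using step(1) by (simp only: W)
    show "integrable M (\<lambda>w. \<xi> k w * f (?W w))"
      using step(2) by (simp only: W)
  qed
  show "integrable M (\<lambda>w. ?W w * f (?W w))"
    using one(2) by (auto simp: sum_distrib_right)
  have "expectation (\<lambda>w. ?W w * f (?W w)) = (\<Sum>k\<in>I. expectation (\<lambda>w. \<xi> k w * f (?W w)))"
    unfolding sum_distrib_right using one(2) by (intro Bochner_Integration.integral_sum)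
  moreover have "expectation (\<lambda>w. f' (?W w))
      = (\<Sum>k\<in>I. expectation (\<lambda>w. (\<xi> k w)\<^sup>2) * expectation (\<lambda>w. f' (?W w)))"
    using var by (simp flip: sum_distrib_right)
  ultimately have "expectation (\<lambda>w. f' (?W w)) - expectation (\<lambda>w. ?W w * f (?W w))
      = (\<Sum>k\<in>I. expectation (\<lambda>w. (\<xi> k w)\<^sup>2) * expectation (\<lambda>w. f' (?W w))
          - expectation (\<lambda>w. \<xi> k w * f (?W w)))"
    by (simp add: sum_subtractf)
  also have "\<bar>\<dots>\<bar> \<le> (\<Sum>k\<in>I. 2 * C * ?e k)"
    by (rule order_trans[OF sum_abs sum_mono]) (rule one(1))
  finally show "\<bar>expectation (\<lambda>w. f' (?W w)) - expectation (\<lambda>w. ?W w * f (?W w))\<bar>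
      \<le> 2 * C * (\<Sum>k\<in>I. ?e k)"
    by (simp add: sum_distrib_left)
qed

section \<open>The total variation bound\<close>

theorem theorem1p1:
  fixes M :: "'a measure" and X :: "nat \<Rightarrow> 'a \<Rightarrow> real"
    and M' :: "'b measure" and N :: "'b \<Rightarrow> real"
    and p p' :: "nat \<Rightarrow> real \<Rightarrow> real"
    and \<sigma> b :: "nat \<Rightarrow> real" and S :: "nat \<Rightarrow> 'a \<Rightarrow> real" and n :: nat
  assumes "prob_space M"
    and "prob_space.indep_vars M (\<lambda>_. borel) X {1..}"
    and "\<And>k. k \<ge> 1 \<Longrightarrow> integrable M (\<lambda>w. (X k w)\<^sup>2)"
    and "\<And>k. k \<ge> 1 \<Longrightarrow> prob_space.expectation M (X k) = 0"
    and "\<And>k. k \<ge> 1 \<Longrightarrow> \<sigma> k > 0"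
    and "\<And>k. k \<ge> 1 \<Longrightarrow> (\<sigma> k)\<^sup>2 = prob_space.expectation M (\<lambda>w. (X k w)\<^sup>2)"
    and "\<And>k x. k \<ge> 1 \<Longrightarrow> p k x \<ge> 0"
    and "\<And>k. k \<ge> 1 \<Longrightarrow> distributed M lborel (X k) (\<lambda>x. ennreal (p k x))"
    and "\<And>k. k \<ge> 1 \<Longrightarrow> abs_cont (p k)"
    and "\<And>k. k \<ge> 1 \<Longrightarrow> has_RN_derivative (p k) (p' k)"
    and "\<And>k. k \<ge> 1 \<Longrightarrow> fisher_J M (X k) (p k) (p' k) < \<infinity>"
    and "n \<ge> 2"
    and "b n = sqrt (\<Sum>k=1..n. (\<sigma> k)\<^sup>2)"
    and "S n = (\<lambda>w. (\<Sum>k=1..n. X k w) / b n)"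
    and "prob_space M'"
    and "distributed M' lborel N (\<lambda>x. ennreal (std_normal_density x))"
  shows "tv_dist M (S n) M' N \<le>
      sqrt ((8 * pi * (MAX k\<in>{1..n}. enn2real (fisher_J M (X k) (p k) (p' k)))) /
            (1 - (MAX k\<in>{1..n}. (\<sigma> k)\<^sup>2 / (b n)\<^sup>2))) *
      ((\<Sum>k=1..n. prob_space.expectation M (\<lambda>w. \<bar>X k w\<bar>\<^sup>2 * min (b n) \<bar>X k w\<bar>)) / (b n) ^ 3)"
proof -
  interpret M: prob_space M by fact
  define I where "I = {1..n}"
  define V where "V = (\<Sum>k\<in>I. (\<sigma> k)\<^sup>2)"
  define \<xi> where "\<xi> k w = X k w / b n" for k w
  define J where "J = (MAX k\<in>I. enn2real (fisher_J M (X k) (p k) (p' k)))"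
  define R where "R = (MAX k\<in>I. (\<sigma> k)\<^sup>2 / (b n)\<^sup>2)"
  define C where "C = sqrt (8 * pi * J / (1 - R))"
  define Q where "Q = (\<Sum>k\<in>I. M.expectation (\<lambda>w. (\<xi> k w)\<^sup>2 * min \<bar>\<xi> k w\<bar> 1))"
  have finI: "finite I" and neI: "I \<noteq> {}" and I1: "\<And>k. k \<in> I \<Longrightarrow> 1 \<le> k"
    using assms(12) by (auto simp: I_def)
  have indX: "M.indep_vars (\<lambda>_. borel) X I"
    by (rule M.indep_vars_subset[OF assms(2)]) (auto simp: I_def)
  have rvX[measurable]: "k \<in> I \<Longrightarrow> X k \<in> borel_measurable M" for k
    using indX by (auto simp: M.indep_vars_def)
  have sq_pos: "0 < (\<sigma> k)\<^sup>2" if "k \<in> I" for k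
    using assms(5)[OF I1[OF that]] by simp
  have others: "I - {k} \<noteq> {}" for k
  proof
    assume "I - {k} = {}"
    then have "card I \<le> 1" using card_mono[of "{k}" I] by auto
    then show False using assms(12) by (simp add: I_def)
  qed
  have less_V: "(\<sigma> k)\<^sup>2 < V" if k: "k \<in> I" for k
  proof -
    have "0 < (\<Sum>i\<in>I - {k}. (\<sigma> i)\<^sup>2)"
      using finI sq_pos others by (intro sum_pos) auto
    then show ?thesis
      using k finI by (simp add: V_def sum.remove)
  qed
  have V: "0 < V"
    unfolding V_def using finI neI sq_pos by (intro sum_pos) auto
  have b_sq: "(b n)\<^sup>2 = V" and b_pos: "0 < b n"
    using V assms(13) by (simp_all add: V_def I_def)
  have R_ge: "(\<sigma> k)\<^sup>2 / V \<le> R" if "k \<in> I" for k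
    unfolding R_def b_sq using that finI by (intro Max_ge) auto
  have R_less: "R < 1"
    unfolding R_def b_sq using finI neI less_V V by (subst Max_less_iff) auto
  have nn_fin: "(\<integral>\<^sup>+x\<in>{x. 0 < p k x}. ennreal ((p' k x)\<^sup>2 / p k x) \<partial>lborel) < \<infinity>"
    and fisher: "(\<sigma> k)\<^sup>2 * enn2real (\<integral>\<^sup>+x\<in>{x. 0 < p k x}. ennreal ((p' k x)\<^sup>2 / p k x) \<partial>lborel) \<le> J"
    if k: "k \<in> I" for k
  proof -
    have eq: "fisher_J M (X k) (p k) (p' k) = ennreal ((\<sigma> k)\<^sup>2)
        * (\<integral>\<^sup>+x\<in>{x. 0 < p k x}. ennreal ((p' k x)\<^sup>2 / p k x) \<partial>lborel)"
      unfolding fisher_J_def using assms(4,6)[OF I1[OF k]] by simp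
    show "(\<integral>\<^sup>+x\<in>{x. 0 < p k x}. ennreal ((p' k x)\<^sup>2 / p k x) \<partial>lborel) < \<infinity>"
      using assms(11)[OF I1[OF k]] sq_pos[OF k] unfolding eq
      by (auto simp: ennreal_mult_less_top)
    have "(\<sigma> k)\<^sup>2 * enn2real (\<integral>\<^sup>+x\<in>{x. 0 < p k x}. ennreal ((p' k x)\<^sup>2 / p k x) \<partial>lborel)
        = enn2real (fisher_J M (X k) (p k) (p' k))"
      unfolding eq by (simp add: enn2real_mult)
    also have "\<dots> \<le> J"
      unfolding J_def using k finI by (intro Max_ge) auto
    finally show "(\<sigma> k)\<^sup>2 * enn2real (\<integral>\<^sup>+x\<in>{x. 0 < p k x}. ennreal ((p' k x)\<^sup>2 / p k x) \<partial>lborel) \<le> J" .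
  qed
  have J0: "0 \<le> J"
  proof -
    obtain k where "k \<in> I" using neI by auto
    then show ?thesis
      using fisher[of k] order_trans[OF mult_nonneg_nonneg[OF zero_le_power2 enn2real_nonneg]] by blast
  qed
  have ind\<xi>: "M.indep_vars (\<lambda>_. borel) \<xi> I"
    unfolding \<xi>_def by (rule M.indep_vars_compose2[OF indX]) measurable
  have sq\<xi>: "integrable M (\<lambda>w. (\<xi> k w)\<^sup>2)" if "k \<in> I" for k
    using assms(3)[OF I1[OF that]] by (simp add: \<xi>_def power_divide)
  have mean\<xi>: "M.expectation (\<xi> k) = 0" if "k \<in> I" for k
    using assms(4)[OF I1[OF that]] by (simp add: \<xi>_def[abs_def])
  have var\<xi>: "(\<Sum>k\<in>I. M.expectation (\<lambda>w. (\<xi> k w)\<^sup>2)) = 1"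
  proof -
    have "(\<Sum>k\<in>I. M.expectation (\<lambda>w. (\<xi> k w)\<^sup>2)) = (\<Sum>k\<in>I. (\<sigma> k)\<^sup>2 / V)"
      using assms(6) I1 by (intro sum.cong) (simp_all add: \<xi>_def power_divide b_sq)
    also have "\<dots> = 1"
      using V by (simp add: V_def flip: sum_divide_distrib)
    finally show ?thesis .
  qed
  have S: "S n = (\<lambda>w. \<Sum>k\<in>I. \<xi> k w)"
    by (simp add: assms(14) I_def \<xi>_def sum_divide_distrib)
  have Q_eq: "Q = (\<Sum>k=1..n. M.expectation (\<lambda>w. \<bar>X k w\<bar>\<^sup>2 * min (b n) \<bar>X k w\<bar>)) / (b n) ^ 3"
  proof -
    have "(\<xi> k w)\<^sup>2 * min \<bar>\<xi> k w\<bar> 1 = \<bar>X k w\<bar>\<^sup>2 * min (b n) \<bar>X k w\<bar> / (b n) ^ 3" for k w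
    proof -
      have "min \<bar>\<xi> k w\<bar> 1 = min (b n) \<bar>X k w\<bar> / b n"
        using b_pos by (auto simp: \<xi>_def min_def abs_divide field_simps)
      then show ?thesis
        using b_pos by (simp add: \<xi>_def power_divide power2_eq_square power3_eq_cube)
    qed
    then show ?thesis
      by (simp add: Q_def I_def sum_divide_distrib)
  qed
  have test: "\<bar>M.expectation (\<lambda>w. h (S n w)) - prob_space.expectation M' (\<lambda>w. h (N w))\<bar> \<le> 2 * C * Q"
    if h: "h \<in> borel_measurable borel" and h1: "\<And>x. \<bar>h x\<bar> \<le> 1" for h :: "real \<Rightarrow> real"
  proof -
    obtain f f' where f: "has_RN_derivative f f'"
      and B: "\<And>x. \<bar>f x\<bar> \<le> sqrt (2 * pi)" "\<And>x. \<bar>f' x\<bar> \<le> 4"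
      and stein: "\<And>x. f' x = x * f x + (h x - (\<integral>y. std_normal_density y * h y \<partial>lborel))"
      using stein_equation_solution[OF h h1] by blast
    have shift: "\<bar>M.expectation (\<lambda>w. f' ((\<Sum>i\<in>I - {k}. \<xi> i w) + x))
        - M.expectation (\<lambda>w. f' ((\<Sum>i\<in>I - {k}. \<xi> i w) + t))\<bar> \<le> C * min \<bar>x - t\<bar> 1"
      if k: "k \<in> I" for k x t
    proof -
      let ?K = "I - {k}"
      let ?T = "\<lambda>w. \<Sum>i\<in>?K. X i w"
      (* g is a function of the unscaled sum; the factor b n undoes the chain rule in its derivative *)
      define g where "g y = b n * (f (x + 1 / b n * y) - f (t + 1 / b n * y))" for y
      define g' where "g' y = f' (x + 1 / b n * y) - f' (t + 1 / b n * y)" for y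
      have "has_RN_derivative g
          (\<lambda>y. b n * (1 / b n * f' (x + 1 / b n * y) - 1 / b n * f' (t + 1 / b n * y)))"
        unfolding g_def using b_pos
        by (intro has_RN_derivative_cmult has_RN_derivative_diff has_RN_derivative_affine f) auto
      moreover have "b n * (1 / b n * u - 1 / b n * v) = u - v" for u v
        using b_pos by (simp add: field_simps)
      ultimately have g: "has_RN_derivative g g'"
        unfolding g'_def[abs_def] by simp
      (* the bound 4 on the derivative of f is absorbed into sqrt (8 * pi) = 2 * sqrt (2 * pi) *)
      have pi4: "4 \<le> sqrt (8 * pi)"
        using pi_ge_two by (intro real_le_rsqrt) simp
      have g_le: "\<bar>g y\<bar> \<le> b n * (sqrt (8 * pi) * min \<bar>x - t\<bar> 1)" for y
      proof -
        let ?x = "x + 1 / b n * y" and ?t = "t + 1 / b n * y"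
        have "\<bar>f ?x - f ?t\<bar> \<le> 4 * \<bar>?x - ?t\<bar>"
          by (rule has_RN_derivative_increment_le[OF f B(2)])
        also have "\<dots> \<le> sqrt (8 * pi) * \<bar>x - t\<bar>"
          using pi4 by (simp add: mult_right_mono)
        finally have "\<bar>f ?x - f ?t\<bar> \<le> sqrt (8 * pi) * \<bar>x - t\<bar>" .
        moreover have "\<bar>f ?x - f ?t\<bar> \<le> sqrt (8 * pi)"
        proof -
          have "sqrt (8 * pi) = sqrt (2\<^sup>2 * (2 * pi))" by simp
          also have "\<dots> = 2 * sqrt (2 * pi)" by (subst real_sqrt_mult) simp
          finally show ?thesis using B(1)[of ?x] B(1)[of ?t] by linarith
        qed
        ultimately have "\<bar>f ?x - f ?t\<bar> \<le> sqrt (8 * pi) * min \<bar>x - t\<bar> 1"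
          by (simp add: min_def)
        then show ?thesis
          unfolding g_def abs_mult using b_pos by (simp add: mult_left_mono)
      qed
      have g'_le: "\<bar>g' y\<bar> \<le> 8" for y
        using B(2)[of "x + 1 / b n * y"] B(2)[of "t + 1 / b n * y"] unfolding g'_def by linarith
      have sumK: "(\<Sum>i\<in>?K. (\<sigma> i)\<^sup>2) = V - (\<sigma> k)\<^sup>2"
        using finI k by (simp add: V_def sum_diff1)
      have "\<bar>M.expectation (\<lambda>w. g' (?T w))\<bar>
          \<le> b n * (sqrt (8 * pi) * min \<bar>x - t\<bar> 1) * sqrt (J / (\<Sum>i\<in>?K. (\<sigma> i)\<^sup>2))"
      proof (rule M.expectation_derivative_sum_le[OF _ others _ _ _ _ _ _ _ g g_le g'_le])
        show "finite ?K" using finI by simp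
        show "M.indep_vars (\<lambda>_. borel) X ?K"
          by (rule M.indep_vars_subset[OF indX]) auto
        fix i assume i: "i \<in> ?K"
        then show "distributed M lborel (X i) (\<lambda>x. ennreal (p i x))" "has_RN_derivative (p i) (p' i)"
          using I1 assms(8,10) by auto
        show "0 \<le> p i x" for x using i I1 assms(7) by auto
        show "(\<integral>\<^sup>+x\<in>{x. 0 < p i x}. ennreal ((p' i x)\<^sup>2 / p i x) \<partial>lborel) < \<infinity>"
          using i by (intro nn_fin) simp
        show "0 < (\<sigma> i)\<^sup>2" using i by (intro sq_pos) simp
        show "(\<sigma> i)\<^sup>2 * enn2real (\<integral>\<^sup>+x\<in>{x. 0 < p i x}. ennreal ((p' i x)\<^sup>2 / p i x) \<partial>lborel) \<le> J"
          using i by (intro fisher) simp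
      qed
      also have "\<dots> = sqrt (V * (8 * pi) * (J / (V - (\<sigma> k)\<^sup>2))) * min \<bar>x - t\<bar> 1"
      proof -
        have "b n = sqrt V"
          using b_sq b_pos by (intro real_sqrt_unique[symmetric]) auto
        then show ?thesis
          by (simp only: sumK real_sqrt_mult mult_ac)
      qed
      also have "V * (8 * pi) * (J / (V - (\<sigma> k)\<^sup>2)) = 8 * pi * J / (1 - (\<sigma> k)\<^sup>2 / V)"
        using V less_V[OF k] by (simp add: field_simps)
      also have "sqrt (8 * pi * J / (1 - (\<sigma> k)\<^sup>2 / V)) * min \<bar>x - t\<bar> 1 \<le> C * min \<bar>x - t\<bar> 1"
      proof (rule mult_right_mono)
        have "8 * pi * J / (1 - (\<sigma> k)\<^sup>2 / V) \<le> 8 * pi * J / (1 - R)"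
          using R_ge[OF k] R_less J0 by (intro divide_left_mono mult_pos_pos) auto
        then show "sqrt (8 * pi * J / (1 - (\<sigma> k)\<^sup>2 / V)) \<le> C"
          by (simp add: C_def)
      qed simp
      finally have bound: "\<bar>M.expectation (\<lambda>w. g' (?T w))\<bar> \<le> C * min \<bar>x - t\<bar> 1" .
      have T: "(\<Sum>i\<in>?K. \<xi> i w) = 1 / b n * ?T w" for w
        by (simp add: \<xi>_def sum_divide_distrib)
      have [measurable]: "f' \<in> borel_measurable borel"
        by (rule has_RN_derivative_measurable_derivative[OF f])
      have int: "integrable M (\<lambda>w. f' (z + 1 / b n * ?T w))" for z
        by (rule M.integrable_const_bound[of _ 4]) (auto simp: B)
      show ?thesis
        using bound int unfolding T g'_def by (simp add: add.commute)
    qed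
    note sum = M.stein_sum[OF finI ind\<xi> sq\<xi> mean\<xi> var\<xi> f B shift]
    let ?W = "\<lambda>w. \<Sum>k\<in>I. \<xi> k w" and ?c = "\<integral>y. std_normal_density y * h y \<partial>lborel"
    have [measurable]: "?W \<in> borel_measurable M"
      unfolding \<xi>_def by measurable
    have intW: "integrable M (\<lambda>w. h (?W w))"
      by (rule M.integrable_const_bound[of _ 1]) (use h h1 in auto)
    have "M.expectation (\<lambda>w. f' (?W w))
        = M.expectation (\<lambda>w. ?W w * f (?W w)) + (M.expectation (\<lambda>w. h (?W w)) - ?c)"
      unfolding stein using sum(2) intW by (simp add: M.prob_space)
    then have "\<bar>M.expectation (\<lambda>w. h (?W w)) - ?c\<bar> \<le> 2 * C * Q"
      using sum(1) unfolding Q_def by simp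
    moreover have "?c = (\<integral>w. h (N w) \<partial>M')"
      using h by (intro distributed_integral[OF assms(16)]) auto
    ultimately show ?thesis
      unfolding S by simp
  qed
  have "(SUP h\<in>{h \<in> borel_measurable borel. \<forall>x. \<bar>h x\<bar> \<le> (1::real)}.
      \<bar>(\<integral>w. h (S n w) \<partial>M) - (\<integral>w. h (N w) \<partial>M')\<bar>) \<le> 2 * C * Q"
  proof (rule cSUP_least)
    have "(\<lambda>_. 0) \<in> {h \<in> borel_measurable borel. \<forall>x. \<bar>h x\<bar> \<le> (1::real)}"
      by simp
    then show "{h \<in> borel_measurable borel. \<forall>x. \<bar>h x\<bar> \<le> (1::real)} \<noteq> {}"
      by blast
  qed (use test in auto)
  then have "tv_dist M (S n) M' N \<le> C * Q"
    unfolding tv_dist_def by simp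
  then show ?thesis
    unfolding C_def Q_eq J_def R_def I_def .
qed

end
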